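(* Let $d_u>0$ and $D>0$. There exists a constant $C>0$, independent of $d_v\in[0,D]$ and $k>0$, such that for any solution $(u^k,v^k)$ of $(P_2^k)$ satisfying $0\le u^k\le M$, $0\le v^k\le M$ on $\mathbb{R}^+\times(0,T)$, we have $$\int_0^T\int_0^\infty kF(u^k,v^k)\,dx\,dt\le C.$$
   Context: $\mathbb{R}^+=[0,\infty)$; $T>0$, $S_T=(0,\infty)\times(0,T)$; $U_0,V_0>0$, $M\ge\max\{U_0,V_0\}$. $T,d_u,U_0,V_0,M,F$ and the family of initial data are fixed. $F:\mathbb{R}^+\times\mathbb{R}^+\to\mathbb{R}^+$ satisfies (i) $F\in C^{0,\alpha}(\mathbb{R}^+\times\mathbb{R}^+)$ for some $\alpha>0$; (ii) $F(u,0)=F(0,v)=0$ for all $u,v\in\mathbb{R}^+$ and $F(u,v)>0$ for $u,v>0$; (iii) $F(\cdot,v)$ and $F(u,\cdot)$ are non-decreasing for all $u,v\in\mathbb{R}^+$. Initial data: for each $k>0$, $u_0^k,v_0^k\in C^2(\mathbb{R}^+)$ satisfy $0\le u_0^k,v_0^k\le M$; $u_0^k(x)\to0$, $v_0^k(x)\to V_0$ as $x\to\infty$; $\|u_0^k\|_{L^1(\mathbb{R}^+)}<\infty$ and $\|v_0^k-V_0\|_{L^1(\mathbb{R}^+)}<\infty$; $u_0^k\to0$ and $v_0^k-V_0\to0$ in $L^1(\mathbb{R}^+)$ as $k\to\infty$; and for each $r>0$ there is a continuous $\omega_r:\mathbb{R}^+\to\mathbb{R}^+$ with $\omega_r(\mu)\to0$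 as $\mu\to0$ and $\|u_0^k(\cdot+\xi)-u_0^k\|_{L^1((r,\infty))}+\|v_0^k(\cdot+\xi)-v_0^k\|_{L^1((r,\infty))}\le\omega_r(|\xi|)$ for all $k>0$, $|\xi|<r/4$. Problem $(P_2^k)$: $u_t=d_uu_{xx}-kF(u,v)$, $v_t=d_vv_{xx}-kF(u,v)$ in $S_T$; $u(0,t)=U_0$, $d_vv_x(0,t)=0$ for $t\in(0,T)$; $u(\cdot,0)=u_0^k$, $v(\cdot,0)=v_0^k$ on $\mathbb{R}^+$ (terms multiplied by $d_v$ are absent when $d_v=0$). Solutions: if $d_v>0$, classical, with $u^k,v^k\in C^{2,1}(\mathbb{R}^+\times[\delta,T])\cap C^0(\mathbb{R}^+\times[0,T])\cap W^{2,1}_p((0,J)\times(0,T))$ for all $\delta,J>0$, $p\ge1$. If $d_v=0$, weak, with $u^k\in W^{2,1}_p((0,J)\times(0,T))$, $v^k\in W^{1,\infty}(0,T;L^\infty((0,J)))$ for all $J>0$, $p\ge1$, and for all $\psi\in C^{2,1}(\overline{S_T})$ with $\psi(\cdot,T)=0$, $\psi(0,t)=0$ for $t\in(0,T)$ and $\operatorname{supp}\psi\subset[0,J]\times[0,T]$ for some $J>0$: $\iint_{S_T}u^k\psi_t+\iint_{S_T}\{d_uu^k\psi_{xx}-kF(u^k,v^k)\psi\}=-\int_0^\infty u_0^k\psi(\cdot,0)-d_uU_0\int_0^T\psi_x(0,t)\,dt$ and $\iint_{S_T}v^k\psi_t-\iint_{S_T}kF(u^k,v^k)\psi=-\int_0^\infty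 v_0^k\psi(\cdot,0)$.
   Formalization: The formal theorem additionally assumes that the L^1 norms of u_0^k are bounded uniformly over all k>0; with only finiteness for each k and convergence to 0 as k→∞ the claim fails (plateaus of height M on [1,n] at k=1+1/n, F=uv, d_v=0, v_0^k=V_0). *)

theory Defs
  imports "HOL-Analysis.Analysis"
begin

text \<open>Functions of space and time are written as functions of the pair \<open>(x, t)\<close>. All functions are
  total; their values outside the stated domains are irrelevant.\<close>

definition S :: "real \<Rightarrow> (real \<times> real) set" where
  "S T = {0<..} \<times> {0<..<T}"


section \<open>Function spaces\<close>

text \<open>On sets that are not open the derivatives are one-sided at the boundary.\<close>

definition C2_on :: "real set \<Rightarrow> (real \<Rightarrow> real) \<Rightarrow> bool" where
  "C2_on X f \<longleftrightarrow> (\<exists>f' f''.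
     (\<forall>x\<in>X. (f has_real_derivative f' x) (at x within X) \<and>
            (f' has_real_derivative f'' x) (at x within X)) \<and>
     continuous_on X f'')"

text \<open>\<open>C21_derivs X I w wx wxx wt\<close>: the function \<open>w\<close> is of class \<open>C\<^sup>2\<^sup>,\<^sup>1\<close> on \<open>X \<times> I\<close>
  with partial derivatives \<open>wx\<close>, \<open>wxx\<close> and \<open>wt\<close> there.\<close>

definition C21_derivs ::
    "real set \<Rightarrow> real set \<Rightarrow> (real \<times> real \<Rightarrow> real) \<Rightarrow> (real \<times> real \<Rightarrow> real) \<Rightarrow>
     (real \<times> real \<Rightarrow> real) \<Rightarrow> (real \<times> real \<Rightarrow> real) \<Rightarrow> bool" where
  "C21_derivs X I w wx wxx wt \<longleftrightarrow>
     (\<forall>x\<in>X. \<forall>t\<in>I.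
        ((\<lambda>y. w (y, t)) has_real_derivative wx (x, t)) (at x within X) \<and>
        ((\<lambda>y. wx (y, t)) has_real_derivative wxx (x, t)) (at x within X) \<and>
        ((\<lambda>s. w (x, s)) has_real_derivative wt (x, t)) (at t within I)) \<and>
     continuous_on (X \<times> I) w \<and> continuous_on (X \<times> I) wx \<and>
     continuous_on (X \<times> I) wxx \<and> continuous_on (X \<times> I) wt"

text \<open>A test function is given together with all its partial derivatives:
  \<open>\<phi> i j\<close> is the derivative of order \<open>i\<close> in \<open>x\<close> and \<open>j\<close> in \<open>t\<close> of
  \<open>\<phi> 0 0\<close>, an element of \<open>C\<^sub>c\<^sup>\<infinity>(\<Omega>)\<close>.\<close>

definition test_function :: "(real \<times> real) set \<Rightarrow> (nat \<Rightarrow> nat \<Rightarrow> real \<times> real \<Rightarrow> real) \<Rightarrow> bool" where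
  "test_function \<Omega> \<phi> \<longleftrightarrow>
     (\<forall>i j. continuous_on UNIV (\<phi> i j) \<and>
       (\<forall>x t. ((\<lambda>y. \<phi> i j (y, t)) has_real_derivative \<phi> (Suc i) j (x, t)) (at x) \<and>
              ((\<lambda>s. \<phi> i j (x, s)) has_real_derivative \<phi> i (Suc j) (x, t)) (at t))) \<and>
     (\<exists>K. compact K \<and> K \<subseteq> \<Omega> \<and> (\<forall>z. z \<notin> K \<longrightarrow> \<phi> 0 0 z = 0))"

definition test_function1 :: "real set \<Rightarrow> (nat \<Rightarrow> real \<Rightarrow> real) \<Rightarrow> bool" where
  "test_function1 I \<phi> \<longleftrightarrow>
     (\<forall>n t. (\<phi> n has_real_derivative \<phi> (Suc n) t) (at t)) \<and>
     (\<exists>K. compact K \<and> K \<subseteq> I \<and> (\<forall>t. t \<notin> K \<longrightarrow> \<phi> 0 t = 0))"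

definition in_Lp :: "real \<Rightarrow> 'a::euclidean_space set \<Rightarrow> ('a \<Rightarrow> real) \<Rightarrow> bool" where
  "in_Lp p \<Omega> f \<longleftrightarrow> f \<in> borel_measurable (lebesgue_on \<Omega>) \<and>
     integrable (lebesgue_on \<Omega>) (\<lambda>z. \<bar>f z\<bar> powr p)"

definition in_Linf :: "'a::euclidean_space set \<Rightarrow> ('a \<Rightarrow> real) \<Rightarrow> bool" where
  "in_Linf \<Omega> f \<longleftrightarrow> f \<in> borel_measurable (lebesgue_on \<Omega>) \<and>
     (\<exists>B. AE z in lebesgue_on \<Omega>. \<bar>f z\<bar> \<le> B)"

text \<open>\<open>w\<close> is the weak derivative of \<open>f\<close> of order \<open>i\<close> in \<open>x\<close> and \<open>j\<close> in \<open>t\<close>; only used for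
  \<open>f\<close> and \<open>w\<close> that are integrable on \<open>\<Omega>\<close>.\<close>

definition weak_deriv ::
    "(real \<times> real) set \<Rightarrow> nat \<Rightarrow> nat \<Rightarrow> (real \<times> real \<Rightarrow> real) \<Rightarrow> (real \<times> real \<Rightarrow> real) \<Rightarrow> bool" where
  "weak_deriv \<Omega> i j f w \<longleftrightarrow> (\<forall>\<phi>. test_function \<Omega> \<phi> \<longrightarrow>
     (LINT z|lebesgue_on \<Omega>. f z * \<phi> i j z) =
     (- 1) ^ (i + j) * (LINT z|lebesgue_on \<Omega>. w z * \<phi> 0 0 z))"

definition in_W21p :: "real \<Rightarrow> (real \<times> real) set \<Rightarrow> (real \<times> real \<Rightarrow> real) \<Rightarrow> bool" where
  "in_W21p p \<Omega> f \<longleftrightarrow> in_Lp p \<Omega> f \<and> (\<exists>fx fxx ft.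
     in_Lp p \<Omega> fx \<and> weak_deriv \<Omega> 1 0 f fx \<and>
     in_Lp p \<Omega> fxx \<and> weak_deriv \<Omega> 2 0 f fxx \<and>
     in_Lp p \<Omega> ft \<and> weak_deriv \<Omega> 0 1 f ft)"

text \<open>\<open>L\<^sup>\<infinity>(I; L\<^sup>\<infinity>(X))\<close> as a Bochner space: \<open>t \<mapsto> w(\<cdot>, t)\<close> is, for almost every \<open>t \<in> I\<close>, the
  \<open>L\<^sup>\<infinity>(X)\<close>-limit of a sequence of simple \<open>L\<^sup>\<infinity>(X)\<close>-valued functions, with essentially bounded norm.
  The representative \<open>w\<close> is taken jointly measurable.\<close>

definition in_Linf_Linf :: "real set \<Rightarrow> real set \<Rightarrow> (real \<times> real \<Rightarrow> real) \<Rightarrow> bool" where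
  "in_Linf_Linf I X w \<longleftrightarrow>
     w \<in> borel_measurable (lebesgue_on (X \<times> I)) \<and>
     (\<exists>(m :: nat \<Rightarrow> nat) (A :: nat \<Rightarrow> nat \<Rightarrow> real set) (g :: nat \<Rightarrow> nat \<Rightarrow> real \<Rightarrow> real).
        (\<forall>n. \<forall>i<m n. A n i \<in> sets lebesgue \<and> in_Linf X (g n i)) \<and>
        (AE t in lebesgue_on I. \<forall>\<epsilon>>0. \<exists>N. \<forall>n\<ge>N. AE x in lebesgue_on X.
           \<bar>(\<Sum>i<m n. indicator (A n i) t * g n i x) - w (x, t)\<bar> \<le> \<epsilon>)) \<and>
     (\<exists>B. AE t in lebesgue_on I. AE x in lebesgue_on X. \<bar>w (x, t)\<bar> \<le> B)"

text \<open>The weak time derivative in \<open>W\<^sup>1\<^sup>,\<^sup>\<infinity>(I; L\<^sup>\<infinity>(X))\<close> is that of an \<open>L\<^sup>\<infinity>(X)\<close>-valued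
  distribution, so the identity is one between elements of \<open>L\<^sup>\<infinity>(X)\<close>.\<close>

definition in_W1inf_Linf :: "real set \<Rightarrow> real set \<Rightarrow> (real \<times> real \<Rightarrow> real) \<Rightarrow> bool" where
  "in_W1inf_Linf I X w \<longleftrightarrow> in_Linf_Linf I X w \<and> (\<exists>wt. in_Linf_Linf I X wt \<and>
     (\<forall>\<phi>. test_function1 I \<phi> \<longrightarrow> (AE x in lebesgue_on X.
        (LINT t|lebesgue_on I. w (x, t) * \<phi> 1 t) = - (LINT t|lebesgue_on I. wt (x, t) * \<phi> 0 t))))"


section \<open>The reaction term and the initial data\<close>

text \<open>\<open>C\<^sup>0\<^sup>,\<^sup>\<alpha>\<close> on the unbounded quadrant is understood locally, i.e. with a Hoelder constant on
  each bounded subset, so that for instance \<open>F u v = u * v\<close> is admitted.\<close>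

definition reaction :: "(real \<Rightarrow> real \<Rightarrow> real) \<Rightarrow> bool" where
  "reaction F \<longleftrightarrow>
     (\<forall>u\<ge>0. \<forall>v\<ge>0. F u v \<ge> 0) \<and>
     (\<exists>\<alpha>>0. \<forall>R. \<exists>H. \<forall>p\<in>{0..R} \<times> {0..R}. \<forall>q\<in>{0..R} \<times> {0..R}.
        \<bar>F (fst p) (snd p) - F (fst q) (snd q)\<bar> \<le> H * dist p q powr \<alpha>) \<and>
     (\<forall>u\<ge>0. F u 0 = 0) \<and> (\<forall>v\<ge>0. F 0 v = 0) \<and> (\<forall>u>0. \<forall>v>0. F u v > 0) \<and>
     (\<forall>v\<ge>0. mono_on {0..} (\<lambda>u. F u v)) \<and> (\<forall>u\<ge>0. mono_on {0..} (\<lambda>v. F u v))"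

definition L1_norm :: "real set \<Rightarrow> (real \<Rightarrow> real) \<Rightarrow> real" where
  "L1_norm X f = (LINT x:X|lborel. \<bar>f x\<bar>)"

definition initial_data ::
    "real \<Rightarrow> real \<Rightarrow> (real \<Rightarrow> real \<Rightarrow> real) \<Rightarrow> (real \<Rightarrow> real \<Rightarrow> real) \<Rightarrow> bool" where
  "initial_data V\<^sub>0 M u\<^sub>0 v\<^sub>0 \<longleftrightarrow>
     (\<forall>k>0. C2_on {0..} (u\<^sub>0 k) \<and> C2_on {0..} (v\<^sub>0 k) \<and>
        (\<forall>x\<ge>0. 0 \<le> u\<^sub>0 k x \<and> u\<^sub>0 k x \<le> M \<and> 0 \<le> v\<^sub>0 k x \<and> v\<^sub>0 k x \<le> M) \<and>
        (u\<^sub>0 k \<longlongrightarrow> 0) at_top \<and> (v\<^sub>0 k \<longlongrightarrow> V\<^sub>0) at_top \<and>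
        set_integrable lborel {0..} (u\<^sub>0 k) \<and>
        set_integrable lborel {0..} (\<lambda>x. v\<^sub>0 k x - V\<^sub>0)) \<and>
     ((\<lambda>k. L1_norm {0..} (u\<^sub>0 k)) \<longlongrightarrow> 0) at_top \<and>
     ((\<lambda>k. L1_norm {0..} (\<lambda>x. v\<^sub>0 k x - V\<^sub>0)) \<longlongrightarrow> 0) at_top \<and>
     (\<forall>r>0. \<exists>\<omega>. continuous_on {0..} \<omega> \<and> (\<forall>\<mu>\<ge>0. \<omega> \<mu> \<ge> 0) \<and> (\<omega> \<longlongrightarrow> 0) (at_right 0) \<and>
        (\<forall>k>0. \<forall>\<xi>. \<bar>\<xi>\<bar> < r / 4 \<longrightarrow>
           L1_norm {r<..} (\<lambda>x. u\<^sub>0 k (x + \<xi>) - u\<^sub>0 k x) +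
           L1_norm {r<..} (\<lambda>x. v\<^sub>0 k (x + \<xi>) - v\<^sub>0 k x) \<le> \<omega> \<bar>\<xi>\<bar>))"


section \<open>Solutions\<close>

text \<open>Here \<open>u\<^sub>0\<close> and \<open>v\<^sub>0\<close> are the initial functions for the value of \<open>k\<close> under consideration.\<close>

definition classical_solution ::
    "real \<Rightarrow> real \<Rightarrow> real \<Rightarrow> real \<Rightarrow> (real \<Rightarrow> real \<Rightarrow> real) \<Rightarrow> real \<Rightarrow> (real \<Rightarrow> real) \<Rightarrow> (real \<Rightarrow> real) \<Rightarrow>
     (real \<times> real \<Rightarrow> real) \<Rightarrow> (real \<times> real \<Rightarrow> real) \<Rightarrow> bool" where
  "classical_solution T d\<^sub>u d\<^sub>v U\<^sub>0 F k u\<^sub>0 v\<^sub>0 u v \<longleftrightarrow>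
     continuous_on ({0..} \<times> {0..T}) u \<and> continuous_on ({0..} \<times> {0..T}) v \<and>
     (\<forall>J>0. \<forall>p\<ge>1. in_W21p p ({0<..<J} \<times> {0<..<T}) u \<and> in_W21p p ({0<..<J} \<times> {0<..<T}) v) \<and>
     (\<exists>ux uxx ut vx vxx vt.
        (\<forall>\<delta>\<in>{0<..<T}. C21_derivs {0..} {\<delta>..T} u ux uxx ut \<and> C21_derivs {0..} {\<delta>..T} v vx vxx vt) \<and>
        (\<forall>z\<in>S T. ut z = d\<^sub>u * uxx z - k * F (u z) (v z) \<and>
                  vt z = d\<^sub>v * vxx z - k * F (u z) (v z)) \<and>
        (\<forall>t\<in>{0<..<T}. u (0, t) = U\<^sub>0 \<and> d\<^sub>v * vx (0, t) = 0)) \<and>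
     (\<forall>x\<ge>0. u (x, 0) = u\<^sub>0 x \<and> v (x, 0) = v\<^sub>0 x)"

definition weak_solution ::
    "real \<Rightarrow> real \<Rightarrow> real \<Rightarrow> (real \<Rightarrow> real \<Rightarrow> real) \<Rightarrow> real \<Rightarrow> (real \<Rightarrow> real) \<Rightarrow> (real \<Rightarrow> real) \<Rightarrow>
     (real \<times> real \<Rightarrow> real) \<Rightarrow> (real \<times> real \<Rightarrow> real) \<Rightarrow> bool" where
  "weak_solution T d\<^sub>u U\<^sub>0 F k u\<^sub>0 v\<^sub>0 u v \<longleftrightarrow>
     (\<forall>J>0. \<forall>p\<ge>1. in_W21p p ({0<..<J} \<times> {0<..<T}) u) \<and>
     (\<forall>J>0. in_W1inf_Linf {0<..<T} {0<..<J} v) \<and>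
     (\<forall>\<psi> \<psi>x \<psi>xx \<psi>t. C21_derivs {0..} {0..T} \<psi> \<psi>x \<psi>xx \<psi>t \<and>
        (\<forall>x\<ge>0. \<psi> (x, T) = 0) \<and> (\<forall>t\<in>{0<..<T}. \<psi> (0, t) = 0) \<and>
        (\<exists>J>0. \<forall>x>J. \<forall>t\<in>{0..T}. \<psi> (x, t) = 0) \<longrightarrow>
        (LINT z|lebesgue_on (S T). u z * \<psi>t z) +
        (LINT z|lebesgue_on (S T). d\<^sub>u * u z * \<psi>xx z - k * F (u z) (v z) * \<psi> z) =
          - (LINT x:{0..}|lborel. u\<^sub>0 x * \<psi> (x, 0))
          - d\<^sub>u * U\<^sub>0 * (LINT t:{0..T}|lborel. \<psi>x (0, t)) \<and>
        (LINT z|lebesgue_on (S T). v z * \<psi>t z) -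
        (LINT z|lebesgue_on (S T). k * F (u z) (v z) * \<psi> z) =
          - (LINT x:{0..}|lborel. v\<^sub>0 x * \<psi> (x, 0)))"

definition solution ::
    "real \<Rightarrow> real \<Rightarrow> real \<Rightarrow> real \<Rightarrow> (real \<Rightarrow> real \<Rightarrow> real) \<Rightarrow> real \<Rightarrow> (real \<Rightarrow> real) \<Rightarrow> (real \<Rightarrow> real) \<Rightarrow>
     (real \<times> real \<Rightarrow> real) \<Rightarrow> (real \<times> real \<Rightarrow> real) \<Rightarrow> bool" where
  "solution T d\<^sub>u d\<^sub>v U\<^sub>0 F k u\<^sub>0 v\<^sub>0 u v \<longleftrightarrow>
     (if d\<^sub>v > 0 then classical_solution T d\<^sub>u d\<^sub>v U\<^sub>0 F k u\<^sub>0 v\<^sub>0 u v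
      else weak_solution T d\<^sub>u U\<^sub>0 F k u\<^sub>0 v\<^sub>0 u v)"

end

theory Submission
  imports Defs
begin

text \<open>Both equations are tested with functions of \<open>x\<close> that stay away from the boundary data: the one for \<open>u\<close>
  with a plateau that vanishes to first order at \<open>x = 0\<close> and equals \<open>1\<close> minus a cutoff up to \<open>x = n\<close>,
  the one for \<open>v\<close> with that cutoff itself. Since the total second variation of the plateau does not depend on \<open>n\<close>,
  each of the two tested reaction terms is bounded uniformly in \<open>n\<close>, and the two test functions add up
  to \<open>1\<close> on \<open>[0, n]\<close>. If \<open>d\<^sub>v = 0\<close>, the test function for \<open>v\<close> also has to vanish at \<open>x = 0\<close>;
  as \<open>v\<close> does not diffuse then, it may do so on a boundary layer of width \<open>3 / n\<close> without any cost.\<close>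

section \<open>Cutoff functions\<close>

text \<open>The two equations are awkward at opposite ends of the half-line. At \<open>x = 0\<close>
  the flux of \<open>u\<close> produced by the Dirichlet condition is not controlled by
  \<open>M\<close>, so its test function must vanish there, and so must the derivative of the test
  function, which would otherwise multiply \<open>U\<^sub>0\<close>. There \<open>v\<close> is
  harmless, having no flux through the boundary. For large \<open>x\<close> the roles are exchanged:
  \<open>v\<close> starts close to \<open>V\<^sub>0 > 0\<close>, so its initial mass under a test
  function of width \<open>n\<close> grows with \<open>n\<close>, whereas that of \<open>u\<close>
  is at most the \<open>L1\<close> norm of the data. The same reaction term stands in both
  equations, so each equation is used only where it is uniform in \<open>n\<close>. Both space
  derivatives are moved onto the test function, so the bounds \<open>0 \<le> u, v \<le> M\<close>
  are all that is asked of the solution; the contribution of the final time has a favourable sign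
  and is dropped. The factor \<open>k\<close> occurs only in the quantity to be estimated, and
  \<open>d\<^sub>v\<close> only as a linear factor, which is why the constant is uniform in
  both.\<close>

lemma has_real_derivative_max_power:
  "((\<lambda>x. max 0 x ^ Suc (Suc n)) has_real_derivative (of_nat (Suc (Suc n)) * max 0 x ^ Suc n)) (at (x::real))"
proof -
  consider "x > 0" | "x < 0" | "x = 0" by linarith
  then show ?thesis
  proof cases
    case 1
    have "((\<lambda>x::real. x ^ Suc (Suc n)) has_real_derivative (of_nat (Suc (Suc n)) * x ^ Suc n)) (at x)"
      using DERIV_pow[of "Suc (Suc n)" x] by simp
    moreover have "open ({0<..} :: real set)" by simp
    ultimately show ?thesis
      by (rule DERIV_cong[OF has_field_derivative_transform_within_open, of _ _ _ "{0<..}"])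
        (use 1 in auto)
  next
    case 2
    have "((\<lambda>x::real. 0) has_real_derivative 0) (at x)"
      by simp
    moreover have "open {..<0::real}" by simp
    ultimately show ?thesis
      by (rule DERIV_cong[OF has_field_derivative_transform_within_open, of _ _ _ "{..<0}"])
        (use 2 in auto)
  next
    case 3
    \<comment> \<open>At the kink the exponent is at least 2, so a positive power of
      \<open>h\<close> survives the division.\<close>
    have "((\<lambda>h::real. max 0 h ^ Suc (Suc n) / h) \<longlongrightarrow> 0) (at 0)"
    proof (rule Lim_null_comparison)
      show "((\<lambda>h::real. \<bar>h\<bar> ^ Suc n) \<longlongrightarrow> 0) (at 0)"
        by (auto intro!: tendsto_eq_intros)
      show "\<forall>\<^sub>F h in at (0::real). norm (max 0 h ^ Suc (Suc n) / h) \<le> \<bar>h\<bar> ^ Suc n"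
        by (intro always_eventually allI) (auto simp: max_def abs_mult intro!: mult_nonpos_nonneg)
    qed
    then show ?thesis
      unfolding 3 DERIV_def by simp
  qed
qed

text \<open>The antiderivative of a quadratic B-spline: it is of class \<open>C\<^sup>2\<close> and descends from \<open>1\<close> to \<open>0\<close> on
  the interval \<open>[0, 3]\<close>.\<close>

definition cutoff :: "real \<Rightarrow> real" where
  "cutoff x = 1 - 1 / 6 *
     (max 0 x ^ 3 - 3 * max 0 (x - 1) ^ 3 + 3 * max 0 (x - 2) ^ 3 - max 0 (x - 3) ^ 3)"

definition cutoff' :: "real \<Rightarrow> real" where
  "cutoff' x = - (1 / 2) *
     (max 0 x ^ 2 - 3 * max 0 (x - 1) ^ 2 + 3 * max 0 (x - 2) ^ 2 - max 0 (x - 3) ^ 2)"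

definition cutoff'' :: "real \<Rightarrow> real" where
  "cutoff'' x = - (max 0 x - 3 * max 0 (x - 1) + 3 * max 0 (x - 2) - max 0 (x - 3))"

lemma has_real_derivative_max_shift:
  "((\<lambda>x. max 0 (x - a) ^ 3) has_real_derivative 3 * max 0 (x - a) ^ 2) (at (x::real))"
  "((\<lambda>x. max 0 (x - a) ^ 2) has_real_derivative 2 * max 0 (x - a)) (at (x::real))"
  using has_real_derivative_max_power[of 1 "x - a"] has_real_derivative_max_power[of 0 "x - a"]
    DERIV_shift[of "\<lambda>x. max 0 x ^ 3" "3 * max 0 (x - a) ^ 2" x "- a"]
    DERIV_shift[of "\<lambda>x. max 0 x ^ 2" "2 * max 0 (x - a)" x "- a"]
  by (simp_all add: numeral_eq_Suc)

lemma has_real_derivative_cutoff: "(cutoff has_real_derivative cutoff' x) (at x)"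
  unfolding cutoff_def[abs_def] cutoff'_def
  by (rule has_real_derivative_max_shift has_real_derivative_max_shift[of 0, simplified]
      refl derivative_eq_intros)+ (simp add: algebra_simps)

lemma has_real_derivative_cutoff': "(cutoff' has_real_derivative cutoff'' x) (at x)"
  unfolding cutoff'_def[abs_def] cutoff''_def
  by (rule has_real_derivative_max_shift has_real_derivative_max_shift[of 0, simplified]
      refl derivative_eq_intros)+ (simp add: algebra_simps)

lemma continuous_cutoff'': "continuous_on A cutoff''"
  unfolding cutoff''_def[abs_def] by (intro continuous_intros)

lemma cutoff_below: "x \<le> 0 \<Longrightarrow> cutoff x = 1" "x \<le> 0 \<Longrightarrow> cutoff' x = 0"
  by (auto simp: cutoff_def cutoff'_def)

lemma cutoff_above: "x \<ge> 3 \<Longrightarrow> cutoff x = 0" "x \<ge> 3 \<Longrightarrow> cutoff' x = 0"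
  by (auto simp: cutoff_def cutoff'_def max_def power2_eq_square power3_eq_cube field_simps)

text \<open>\<open>- cutoff'\<close> is the quadratic B-spline with knots \<open>0, 1, 2, 3\<close>;
  its pieces are \<open>x^2 / 2\<close>, \<open>(x - 1) * (2 - x) + 1 / 2\<close> and
  \<open>(3 - x)^2 / 2\<close>.\<close>

lemma cutoff'_nonpos: "cutoff' x \<le> 0"
proof -
  consider "x \<le> 0" | "0 < x" "x \<le> 1" | "1 < x" "x \<le> 2" | "2 < x" "x \<le> 3" | "x \<ge> 3" by linarith
  then show ?thesis
  proof cases
    case 3
    have "x\<^sup>2 - 3 * (x - 1)\<^sup>2 = 2 * ((x - 1) * (2 - x)) + 1"
      by (simp add: power2_eq_square algebra_simps)
    moreover have "0 \<le> (x - 1) * (2 - x)"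
      using 3 by simp
    ultimately have "0 \<le> x\<^sup>2 - 3 * (x - 1)\<^sup>2"
      by linarith
    then show ?thesis
      using 3 by (simp add: cutoff'_def)
  next
    case 4
    have "x\<^sup>2 - 3 * (x - 1)\<^sup>2 + 3 * (x - 2)\<^sup>2 = (3 - x)\<^sup>2"
      by (simp add: power2_eq_square algebra_simps)
    then show ?thesis
      using 4 by (simp add: cutoff'_def max_def)
  next
    case 2
    then show ?thesis
      by (simp add: cutoff'_def)
  qed (simp_all add: cutoff_above cutoff_below)
qed

lemma cutoff_antimono: "x \<le> y \<Longrightarrow> cutoff y \<le> cutoff x"
  using DERIV_nonpos_imp_nonincreasing[of x y cutoff] has_real_derivative_cutoff cutoff'_nonpos
  by blast

lemma cutoff_nonneg: "0 \<le> cutoff x" and cutoff_le_1: "cutoff x \<le> 1"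
  using cutoff_antimono[of x "max x 3"] cutoff_antimono[of "min x 0" x]
  by (auto simp: cutoff_above cutoff_below)

text \<open>\<open>cutoff''\<close> is piecewise linear with the values \<open>0, -1, 1, 0\<close>
  at the knots \<open>0, 1, 2, 3\<close>. Height 1 and width 3 of this window are the source of the
  later numerical constants.\<close>

lemma abs_cutoff''_le: "\<bar>cutoff'' x\<bar> \<le> indicator {0..3} x"
proof -
  consider "x < 0" | "0 \<le> x" "x \<le> 1" | "1 < x" "x \<le> 2" | "2 < x" "x \<le> 3" | "x > 3" by linarith
  then show ?thesis
    by cases (auto simp: cutoff''_def max_def abs_le_iff)
qed

lemma continuous_cutoff: "continuous_on A cutoff" and continuous_cutoff': "continuous_on A cutoff'"
  by (rule DERIV_continuous_on, rule has_field_derivative_at_within,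
      rule has_real_derivative_cutoff has_real_derivative_cutoff')+

lemma continuous_on_cutoff [continuous_intros]:
  assumes "continuous_on A g"
  shows "continuous_on A (\<lambda>x. cutoff (g x))" "continuous_on A (\<lambda>x. cutoff' (g x))"
    "continuous_on A (\<lambda>x. cutoff'' (g x))"
  using assms continuous_cutoff continuous_cutoff' continuous_cutoff''
  by (auto intro: continuous_on_compose2[of UNIV])

text \<open>A difference of two translates, so that adding \<open>cutoff\<close> gives
  \<open>cutoff (x - real n)\<close>, which is 1 up to \<open>x = n\<close>. For
  \<open>n < 3\<close> the ascent and the descent overlap and the level 1 is not reached, but the
  bounds below hold all the same.\<close>

definition plateau :: "nat \<Rightarrow> real \<Rightarrow> real" where
  "plateau n x = cutoff (x - real n) - cutoff x"

definition plateau' :: "nat \<Rightarrow> real \<Rightarrow> real" where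
  "plateau' n x = cutoff' (x - real n) - cutoff' x"

definition plateau'' :: "nat \<Rightarrow> real \<Rightarrow> real" where
  "plateau'' n x = cutoff'' (x - real n) - cutoff'' x"

lemma has_real_derivative_plateau:
  "(plateau n has_real_derivative plateau' n x) (at x)"
  "(plateau' n has_real_derivative plateau'' n x) (at x)"
  unfolding plateau_def[abs_def] plateau'_def[abs_def] plateau''_def
  using DERIV_shift[of cutoff "cutoff' (x - real n)" x "- real n"]
    DERIV_shift[of cutoff' "cutoff'' (x - real n)" x "- real n"]
  by (auto intro!: DERIV_diff has_real_derivative_cutoff has_real_derivative_cutoff')

lemma continuous_plateau: "continuous_on A (plateau n)" "continuous_on A (plateau'' n)"
  unfolding plateau_def[abs_def] plateau''_def[abs_def] by (intro continuous_intros)+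

lemma plateau_nonneg: "0 \<le> plateau n x" and plateau_le_1: "plateau n x \<le> 1"
  using cutoff_antimono[of "x - real n" x] cutoff_le_1[of "x - real n"] cutoff_nonneg[of x]
  by (auto simp: plateau_def)

lemma plateau_0: "plateau n 0 = 0" "plateau' n 0 = 0"
  by (simp_all add: plateau_def plateau'_def cutoff_below)

lemma plateau_above:
  assumes "real n + 3 \<le> x"
  shows "plateau n x = 0" "plateau' n x = 0"
proof -
  have "3 \<le> x - real n" "3 \<le> x"
    using assms by linarith+
  then show "plateau n x = 0" "plateau' n x = 0"
    by (simp_all add: plateau_def plateau'_def cutoff_above)
qed

text \<open>Two windows of fixed width wherever the descent takes place: this makes the diffusion
  term uniform in \<open>n\<close>. The upper end \<open>0 + 3\<close> matches the pattern
  \<open>{a..a + 3}\<close> of \<open>integral_le_windows\<close>.\<close>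

lemma abs_plateau''_le:
  "\<bar>plateau'' n x\<bar> \<le> indicator {0..0 + 3} x + indicator {real n..real n + 3} x"
proof -
  have "\<bar>plateau'' n x\<bar> \<le> indicator {0..3} (x - real n) + indicator {0..3} x"
    unfolding plateau''_def
    by (rule order_trans[OF abs_triangle_ineq4 add_mono[OF abs_cutoff''_le abs_cutoff''_le]])
  also have "\<dots> = indicator {0..0 + 3} x + indicator {real n..real n + 3} x"
    by (auto simp: indicator_def)
  finally show ?thesis .
qed

section \<open>Measurability, exhaustion of the strip and the data\<close>

text \<open>The inner integrand need not be Borel measurable for a merely Lebesgue measurable function, so
  Tonelli's theorem is applied to a Borel majorant that agrees with it almost everywhere.\<close>

lemma iterated_nn_integral_le_lebesgue:
  fixes h :: "real \<times> real \<Rightarrow> ennreal"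
  assumes "h \<in> borel_measurable lebesgue"
  shows "(\<integral>\<^sup>+t. (\<integral>\<^sup>+x. h (x, t) \<partial>lborel) \<partial>lborel) \<le> (\<integral>\<^sup>+z. h z \<partial>lebesgue)"
proof -
  obtain g where g [measurable]: "g \<in> borel_measurable lborel" and eq: "AE z in lborel. h z = g z"
    using completion_ex_borel_measurable[OF assms] by blast
  obtain N where sub: "{z \<in> space lborel. \<not> h z = g z} \<subseteq> N"
    and null: "emeasure lborel N = 0" and N [measurable]: "N \<in> sets lborel"
    using eq by (rule AE_E)
  \<comment> \<open>The value infinity on the Borel null set \<open>N\<close> makes \<open>G\<close>
    a majorant at every point, not just almost everywhere, and does not change its integral.\<close>
  define G where "G z = g z + \<infinity> * indicator N z" for z
  have G [measurable]: "G \<in> borel_measurable (lborel \<Otimes>\<^sub>M lborel)"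
    unfolding G_def[abs_def] lborel_prod by measurable
  have "h z \<le> G z" for z
    using sub by (cases "h z = g z") (auto simp: G_def)
  \<comment> \<open>Monotonicity of the nonnegative integral holds without measurability, so the
    inner integrals of \<open>h\<close> may be compared as they are.\<close>
  then have "(\<integral>\<^sup>+t. (\<integral>\<^sup>+x. h (x, t) \<partial>lborel) \<partial>lborel) \<le> (\<integral>\<^sup>+t. (\<integral>\<^sup>+x. G (x, t) \<partial>lborel) \<partial>lborel)"
    by (intro nn_integral_mono)
  also have "\<dots> = (\<integral>\<^sup>+z. G z \<partial>lborel)"
    using lborel_pair.nn_integral_snd[OF G] by (simp add: lborel_prod)
  also have "\<dots> = (\<integral>\<^sup>+z. h z \<partial>lborel)"
  proof (rule nn_integral_cong_AE)
    have "AE z in lborel. z \<notin> N"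
      using N null by (intro AE_not_in null_setsI) auto
    with eq show "AE z in lborel. G z = h z"
      by eventually_elim (simp add: G_def)
  qed
  finally show ?thesis
    by (simp add: nn_integral_completion)
qed

text \<open>A violation in \<open>\<Omega>\<close> would by continuity fill a nonempty open set,
  which is not negligible; limits then carry the bounds to the closure. For classical solutions this
  yields them also at the times \<open>0\<close> and \<open>T\<close>, where the balance evaluates
  the solution.\<close>

lemma ae_imp_on_closure:
  fixes w :: "'a::euclidean_space \<Rightarrow> real"
  assumes "open \<Omega>" and cont: "continuous_on (closure \<Omega>) w"
    and ae: "AE z in lebesgue_on \<Omega>. a \<le> w z \<and> w z \<le> b" and z: "z \<in> closure \<Omega>"
  shows "a \<le> w z \<and> w z \<le> b"
proof -
  have "\<forall>z\<in>\<Omega>. a \<le> w z \<and> w z \<le> b"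
  proof (rule ccontr)
    assume contra: "\<not> (\<forall>z\<in>\<Omega>. a \<le> w z \<and> w z \<le> b)"
    define Z where "Z = \<Omega> \<inter> w -` (- {a..b})"
    have "continuous_on \<Omega> w"
      using cont closure_subset by (rule continuous_on_subset)
    then have "open Z"
      unfolding Z_def using \<open>open \<Omega>\<close> by (intro continuous_open_preimage) auto
    moreover have "Z \<noteq> {}"
      using contra by (auto simp: Z_def)
    moreover have "negligible Z"
    proof -
      have "AE z in lebesgue. z \<in> \<Omega> \<longrightarrow> a \<le> w z \<and> w z \<le> b"
        using ae \<open>open \<Omega>\<close> by (subst (asm) AE_restrict_space_iff) auto
      then have "AE z in lebesgue. z \<notin> Z"
        by eventually_elim (auto simp: Z_def)
      moreover have "Z \<in> sets lebesgue"
        using \<open>open Z\<close> by simp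
      ultimately show ?thesis
        by (simp add: negligible_iff_null_sets AE_iff_null_sets)
    qed
    ultimately show False
      using open_not_negligible by blast
  qed
  then show ?thesis
    using continuous_ge_on_closure[OF cont z] continuous_le_on_closure[OF cont z] by blast
qed

text \<open>On this set the test functions for weak solutions add up to 1:
  \<open>3 / n \<le> x\<close> lies beyond the boundary layer, \<open>x \<le> n\<close> before the
  descent of the plateau, and \<open>t \<le> T - 3 / n\<close> before the descent of the time
  factor.\<close>

definition exhaustion :: "real \<Rightarrow> nat \<Rightarrow> (real \<times> real) set" where
  "exhaustion T n = {3 / real n..real n} \<times> {0<..T - 3 / real n}"

lemma exhaustion_subset: "n \<ge> 1 \<Longrightarrow> exhaustion T n \<subseteq> S T"
proof
  fix z assume "n \<ge> 1" "z \<in> exhaustion T n"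
  moreover from \<open>n \<ge> 1\<close> have "0 < 3 / real n"
    by simp
  ultimately show "z \<in> S T"
    unfolding exhaustion_def S_def mem_Times_iff atLeastAtMost_iff greaterThanAtMost_iff
      greaterThan_iff greaterThanLessThan_iff by linarith
qed

lemma iterated_nn_integral_le_of_exhaustion:
  fixes f :: "real \<times> real \<Rightarrow> real"
  assumes f: "f \<in> borel_measurable (lebesgue_on (S T))"
    and le: "\<And>n. n \<ge> 1 \<Longrightarrow> (\<integral>\<^sup>+z\<in>exhaustion T n. ennreal (f z) \<partial>lebesgue) \<le> C"
  shows "(\<integral>\<^sup>+t\<in>{0<..<T}. (\<integral>\<^sup>+x\<in>{0<..}. ennreal (f (x, t)) \<partial>lborel) \<partial>lborel) \<le> C"
proof -
  have ST [measurable]: "S T \<in> sets lebesgue"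
    unfolding S_def by (intro lmeasurable_open borel_open sets_completionI_sets)
      (simp_all add: open_Times)
  have E: "exhaustion T n \<in> sets lebesgue" for n
    unfolding exhaustion_def by (intro sets_completionI_sets) (simp add: borel_Times)
  define h where "h z = ennreal (f z) * indicator (S T) z" for z
  have h: "h \<in> borel_measurable lebesgue"
    unfolding h_def using f ST
    by (subst borel_measurable_restrict_space_iff_ennreal[symmetric]) auto
  have "(\<integral>\<^sup>+t\<in>{0<..<T}. (\<integral>\<^sup>+x\<in>{0<..}. ennreal (f (x, t)) \<partial>lborel) \<partial>lborel)
      = (\<integral>\<^sup>+t. (\<integral>\<^sup>+x. h (x, t) \<partial>lborel) \<partial>lborel)"
    by (intro nn_integral_cong) (auto simp: h_def S_def indicator_def intro!: nn_integral_cong)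
  also have "\<dots> \<le> (\<integral>\<^sup>+z. h z \<partial>lebesgue)"
    by (rule iterated_nn_integral_le_lebesgue[OF h])
  \<comment> \<open>The shift to \<open>Suc n\<close> keeps out \<open>n = 0\<close>: there
    \<open>3 / real 0 = 0\<close>, and the set would lie on the boundary line \<open>x = 0\<close>,
    outside \<open>S T\<close>.\<close>
  also have "\<dots> = (\<integral>\<^sup>+z. (SUP n. h z * indicator (exhaustion T (Suc n)) z) \<partial>lebesgue)"
  proof (rule nn_integral_cong)
    fix z :: "real \<times> real"
    show "h z = (SUP n. h z * indicator (exhaustion T (Suc n)) z)"
    proof (cases "z \<in> S T")
      case True
      then have pos: "0 < fst z" "0 < snd z" "snd z < T"
        by (auto simp: S_def)
      obtain n :: nat where n: "real n > max (fst z) (max (3 / fst z) (3 / (T - snd z)))"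
        using reals_Archimedean2 by blast
      then have "z \<in> exhaustion T (Suc n)"
        using pos by (auto simp: exhaustion_def mem_Times_iff field_simps)
      then have "h z \<le> (SUP n. h z * indicator (exhaustion T (Suc n)) z)"
        by (intro SUP_upper2[of n]) auto
      moreover have "(SUP n. h z * indicator (exhaustion T (Suc n)) z) \<le> h z"
        by (intro SUP_least) (auto simp: indicator_def)
      ultimately show ?thesis
        by (rule antisym)
    qed (simp add: h_def)
  qed
  also have "\<dots> = (SUP n. \<integral>\<^sup>+z. h z * indicator (exhaustion T (Suc n)) z \<partial>lebesgue)"
  proof (rule nn_integral_monotone_convergence_SUP)
    have "exhaustion T m \<subseteq> exhaustion T n" if "1 \<le> m" "m \<le> n" for m n
    proof -
      have "3 / real n \<le> 3 / real m"
        using that by (intro divide_left_mono) auto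
      then show ?thesis
        using that by (auto simp: exhaustion_def)
    qed
    then have ind: "indicator (exhaustion T (Suc m)) z \<le> (indicator (exhaustion T (Suc n)) z :: ennreal)"
      if "m \<le> n" for m n z
      using that by (intro indicator_leI) auto
    show "incseq (\<lambda>n z. h z * indicator (exhaustion T (Suc n)) z)"
      by (intro monoI le_funI mult_left_mono ind zero_le)
    show "(\<lambda>z. h z * indicator (exhaustion T (Suc n)) z) \<in> borel_measurable lebesgue" for n
      using h E by measurable
  qed
  also have "\<dots> \<le> C"
  proof (rule SUP_least)
    fix n
    have "(\<integral>\<^sup>+z. h z * indicator (exhaustion T (Suc n)) z \<partial>lebesgue)
        = (\<integral>\<^sup>+z\<in>exhaustion T (Suc n). ennreal (f z) \<partial>lebesgue)"
      using exhaustion_subset[of "Suc n" T]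
      by (intro nn_integral_cong) (auto simp: h_def indicator_def)
    then show "(\<integral>\<^sup>+z. h z * indicator (exhaustion T (Suc n)) z \<partial>lebesgue) \<le> C"
      using le[of "Suc n"] by simp
  qed
  finally show ?thesis .
qed

section \<open>Continuity of the reaction term and bounds for weighted integrals\<close>

lemma reaction_nonneg: "reaction F \<Longrightarrow> u \<ge> 0 \<Longrightarrow> v \<ge> 0 \<Longrightarrow> F u v \<ge> 0"
  by (simp add: reaction_def)

lemma reaction_continuous_on:
  assumes "reaction F"
  shows "continuous_on ({0..} \<times> {0..}) (\<lambda>p. F (fst p) (snd p))"
proof -
  obtain \<alpha> where "\<alpha> > 0" and Hoelder: "\<And>R. \<exists>H. \<forall>p\<in>{0..R} \<times> {0..R}. \<forall>q\<in>{0..R} \<times> {0..R}.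
      \<bar>F (fst p) (snd p) - F (fst q) (snd q)\<bar> \<le> H * dist p q powr \<alpha>"
    using assms by (auto simp: reaction_def)
  show ?thesis
    unfolding continuous_on_def
  proof
    fix p :: "real \<times> real" assume p: "p \<in> {0..} \<times> {0..}"
    \<comment> \<open>The margin 1 ensures that all points of the quadrant at distance less than 1
      from \<open>p\<close> lie in the square of side \<open>R\<close>, where a single Hoelder
      constant applies.\<close>
    define R where "R = max (fst p) (snd p) + 1"
    have pR: "p \<in> {0..R} \<times> {0..R}"
      using p by (auto simp: R_def mem_Times_iff)
    obtain H where H: "\<And>q. q \<in> {0..R} \<times> {0..R} \<Longrightarrow>
        \<bar>F (fst q) (snd q) - F (fst p) (snd p)\<bar> \<le> H * dist q p powr \<alpha>"
      using Hoelder[of R] pR by blast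
    have "\<forall>\<^sub>F q in at p within {0..} \<times> {0..}. dist q p < 1"
      by (rule tendstoD) (auto intro!: tendsto_intros)
    moreover have "\<forall>\<^sub>F q in at p within {0..} \<times> {0..}. q \<in> {0..} \<times> {0..}"
      by (simp add: eventually_at_filter)
    ultimately have "\<forall>\<^sub>F q in at p within {0..} \<times> {0..}.
        norm (F (fst q) (snd q) - F (fst p) (snd p)) \<le> H * dist q p powr \<alpha>"
    proof eventually_elim
      case (elim q)
      have "\<bar>fst q - fst p\<bar> < 1" "\<bar>snd q - snd p\<bar> < 1"
        using elim(1) dist_fst_le[of q p] dist_snd_le[of q p] by (auto simp: dist_real_def)
      then have "q \<in> {0..R} \<times> {0..R}"
        using elim(2) by (auto simp: R_def mem_Times_iff)
      then show ?case
        using H by simp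
    qed
    moreover have "((\<lambda>q. H * dist q p powr \<alpha>) \<longlongrightarrow> H * 0 powr \<alpha>) (at p within {0..} \<times> {0..})"
    proof (intro tendsto_mult tendsto_const tendsto_powr2)
      show "((\<lambda>q. dist q p) \<longlongrightarrow> 0) (at p within {0..} \<times> {0..})"
        using tendsto_dist[OF tendsto_ident_at tendsto_const, of p p "{0..} \<times> {0..}"] by simp
    qed (use \<open>\<alpha> > 0\<close> in auto)
    ultimately have "((\<lambda>q. F (fst q) (snd q) - F (fst p) (snd p)) \<longlongrightarrow> 0) (at p within {0..} \<times> {0..})"
      using \<open>\<alpha> > 0\<close> by (simp add: Lim_null_comparison[of _ "\<lambda>q. H * dist q p powr \<alpha>"])
    then show "((\<lambda>q. F (fst q) (snd q)) \<longlongrightarrow> F (fst p) (snd p)) (at p within {0..} \<times> {0..})"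
      by (rule LIM_zero_cancel)
  qed
qed

lemma L1_norm_weighted:
  fixes w p :: "real \<Rightarrow> real"
  assumes int: "set_integrable lborel {0..} w" and w: "\<And>x. x \<ge> 0 \<Longrightarrow> 0 \<le> w x"
    and p: "continuous_on UNIV p" "\<And>x. x \<ge> 0 \<Longrightarrow> 0 \<le> p x" "\<And>x. x \<ge> 0 \<Longrightarrow> p x \<le> 1"
  shows "set_integrable lborel {0..} (\<lambda>x. w x * p x)"
    and "(LINT x:{0..}|lborel. w x * p x) \<le> L1_norm {0..} w"
proof -
  have [measurable]: "p \<in> borel_measurable borel"
    using p(1) by (rule borel_measurable_continuous_onI)
  have i: "integrable lborel (\<lambda>x. indicator {0..} x * w x)"
    using int by (simp add: set_integrable_def)
  have "integrable lborel (\<lambda>x. (indicator {0..} x * w x) * p x)"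
  proof (rule Bochner_Integration.integrable_bound[OF i])
    show "AE x in lborel. norm (indicator {0..} x * w x * p x) \<le> norm (indicator {0..} x * w x)"
      using p by (auto simp: indicator_def abs_mult mult_left_le)
  qed (use i in measurable)
  then show int': "set_integrable lborel {0..} (\<lambda>x. w x * p x)"
    by (simp add: set_integrable_def mult.assoc)
  have "set_integrable lborel {0..} (\<lambda>x. \<bar>w x\<bar>)"
    using int by (rule set_integrable_abs)
  with int' show "(LINT x:{0..}|lborel. w x * p x) \<le> L1_norm {0..} w"
    unfolding L1_norm_def by (rule set_integral_mono) (use w p in \<open>auto simp: mult_left_le\<close>)
qed

text \<open>The origin of the factor 6: two windows of length 3, which may overlap or stick out of
  \<open>{0..J}\<close>.\<close>

lemma integral_le_windows:
  fixes p :: "real \<Rightarrow> real"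
  assumes "p integrable_on {0..J}" and "0 \<le> M"
    and "\<And>x. x \<in> {0..J} \<Longrightarrow> p x \<le> M * (indicator {a..a + 3} x + indicator {b..b + 3} x)"
  shows "integral {0..J} p \<le> 6 * M"
proof -
  have window: "((\<lambda>x. indicator {c..c + 3} x :: real) has_integral measure lebesgue ({c..c + 3} \<inter> {0..J})) {0..J}" for c
    unfolding has_integral_integrable_integral
    by (intro conjI integral_indicator integrable_on_indicator[THEN iffD2]) auto
  have le3: "measure lebesgue ({c..c + 3} \<inter> {0..J}) \<le> 3" for c
  proof -
    have "measure lebesgue ({c..c + 3} \<inter> {0..J}) \<le> measure lebesgue {c..c + 3}"
      by (rule measure_mono_fmeasurable) auto
    then show ?thesis by simp
  qed
  have "integral {0..J} p \<le> M * (measure lebesgue ({a..a + 3} \<inter> {0..J}) + measure lebesgue ({b..b + 3} \<inter> {0..J}))"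
    by (rule has_integral_le[OF integrable_integral[OF assms(1)]
        has_integral_mult_right[OF has_integral_add[OF window window]]]) (use assms(3) in auto)
  also have "\<dots> \<le> M * (3 + 3)"
    by (intro mult_left_mono add_mono le3 \<open>0 \<le> M\<close>)
  finally show ?thesis by simp
qed

section \<open>Classical solutions\<close>

lemma continuous_on_slice_integral:
  fixes w :: "real \<times> real \<Rightarrow> real" and p :: "real \<Rightarrow> real"
  assumes "continuous_on ({0..} \<times> I) w" and "continuous_on UNIV p"
  shows "continuous_on I (\<lambda>t. integral {0..J} (\<lambda>x. w (x, t) * p x))"
proof -
  have "continuous_on (I \<times> cbox 0 J) (\<lambda>(t, x). w (x, t) * p x)"
    unfolding split_beta
    by (intro continuous_intros continuous_on_compose2[OF assms(1)] continuous_on_compose2[OF assms(2)])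
      auto
  then show ?thesis
    unfolding box_real[symmetric] by (rule integral_continuous_on_param)
qed

lemma slice_integrable:
  fixes w :: "real \<times> real \<Rightarrow> real" and p :: "real \<Rightarrow> real"
  assumes "continuous_on ({0..} \<times> I) w" and "continuous_on UNIV p" and "t \<in> I"
  shows "(\<lambda>x. w (x, t) * p x) integrable_on {0..J}"
  by (intro integrable_continuous_real continuous_intros continuous_on_compose2[OF assms(1)]
      continuous_on_subset[OF assms(2)]) (use assms(3) in auto)

text \<open>The mass of \<open>w\<close> against \<open>\<phi>\<close> is differentiated under the
  integral sign, and two integrations by parts move the second derivative to \<open>\<phi>\<close>.
  The boundary terms at \<open>J\<close> vanish with \<open>\<phi>\<close> and
  \<open>\<phi>'\<close>; at \<open>0\<close> one vanishes with \<open>\<phi>'\<close>, the other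
  because of \<open>\<phi> 0 = 0\<close> (for \<open>u\<close>) or of the Neumann condition (for
  \<open>v\<close>), so that one statement serves both equations. The derivatives are controlled
  only away from \<open>t = 0\<close>; integration in time therefore rests on continuity on
  \<open>[0, T]\<close> and differentiability inside.\<close>

lemma classical_balance:
  fixes w wx wxx wt f :: "real \<times> real \<Rightarrow> real" and \<phi> \<phi>' \<phi>'' :: "real \<Rightarrow> real"
  assumes "0 < T" and "0 < J"
    and w: "continuous_on ({0..} \<times> {0..T}) w" and f: "continuous_on ({0..} \<times> {0..T}) f"
    and C21: "\<And>\<delta>. \<delta> \<in> {0<..<T} \<Longrightarrow> C21_derivs {0..} {\<delta>..T} w wx wxx wt"
    and eq: "\<And>x t. 0 < x \<Longrightarrow> 0 < t \<Longrightarrow> t < T \<Longrightarrow> wt (x, t) = d * wxx (x, t) - f (x, t)"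
    and \<phi>: "\<And>x. (\<phi> has_real_derivative \<phi>' x) (at x)"
    and \<phi>': "\<And>x. (\<phi>' has_real_derivative \<phi>'' x) (at x)" and \<phi>'': "continuous_on UNIV \<phi>''"
    and J: "\<phi> J = 0" "\<phi>' J = 0" and "\<phi>' 0 = 0"
    and bd: "\<And>t. 0 < t \<Longrightarrow> t < T \<Longrightarrow> wx (0, t) * \<phi> 0 = 0"
  shows "integral {0..T} (\<lambda>t. integral {0..J} (\<lambda>x. f (x, t) * \<phi> x)) =
    integral {0..J} (\<lambda>x. w (x, 0) * \<phi> x) - integral {0..J} (\<lambda>x. w (x, T) * \<phi> x) +
    d * integral {0..T} (\<lambda>t. integral {0..J} (\<lambda>x. w (x, t) * \<phi>'' x))"
proof -
  define g where "g t = integral {0..J} (\<lambda>x. w (x, t) * \<phi> x)" for t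
  define a where "a t = integral {0..J} (\<lambda>x. w (x, t) * \<phi>'' x)" for t
  define b where "b t = integral {0..J} (\<lambda>x. f (x, t) * \<phi> x)" for t
  have c\<phi>: "continuous_on UNIV \<phi>" and c\<phi>': "continuous_on UNIV \<phi>'"
    using \<phi> \<phi>' by (auto intro!: continuous_at_imp_continuous_on DERIV_isCont)
  have g: "continuous_on {0..T} g" and a: "continuous_on {0..T} a" and b: "continuous_on {0..T} b"
    unfolding g_def[abs_def] a_def[abs_def] b_def[abs_def]
    by (intro continuous_on_slice_integral w f c\<phi> \<phi>'')+
  have "(g has_real_derivative d * a t - b t) (at t)" if t: "t \<in> {0<..<T}" for t
  proof -
    \<comment> \<open>With the left end \<open>t / 2\<close> the time \<open>t\<close> is interior
      to \<open>{t / 2..T}\<close>, and the derivative relative to that interval is an ordinary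
      one.\<close>
    have \<delta>: "t / 2 \<in> {0<..<T}" "t \<in> {t / 2..T}"
      using t by auto
    note C = C21[OF \<delta>(1), unfolded C21_derivs_def]
    have dw: "((\<lambda>y. w (y, s)) has_real_derivative wx (x, s)) (at x within {0..})"
      "((\<lambda>y. wx (y, s)) has_real_derivative wxx (x, s)) (at x within {0..})"
      "((\<lambda>r. w (x, r)) has_real_derivative wt (x, s)) (at s within {t / 2..T})"
      if "x \<ge> 0" "s \<in> {t / 2..T}" for x s
      using C that by auto
    have cw: "continuous_on ({0..} \<times> {t / 2..T}) w"
      and cwxx: "continuous_on ({0..} \<times> {t / 2..T}) wxx"
      and cwt: "continuous_on ({0..} \<times> {t / 2..T}) wt"
      using C by auto
    have cf: "continuous_on ({0..} \<times> {t / 2..T}) f"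
      using f by (rule continuous_on_subset) (use t in auto)
    have "((\<lambda>t. integral (cbox 0 J) (\<lambda>x. w (x, t) * \<phi> x)) has_real_derivative
        integral (cbox 0 J) (\<lambda>x. wt (x, t) * \<phi> x)) (at t within {t / 2..T})"
    proof (rule leibniz_rule_field_derivative)
      show "((\<lambda>t. w (x, t) * \<phi> x) has_real_derivative wt (x, s) * \<phi> x) (at s within {t / 2..T})"
        if "s \<in> {t / 2..T}" "x \<in> cbox 0 J" for s x
        using dw(3)[of x s] that by (intro DERIV_cmult_right) auto
      show "(\<lambda>x. w (x, s) * \<phi> x) integrable_on cbox 0 J" if "s \<in> {t / 2..T}" for s
        using slice_integrable[OF cw c\<phi> that] by simp
      show "continuous_on ({t / 2..T} \<times> cbox 0 J) (\<lambda>(s, x). wt (x, s) * \<phi> x)"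
        unfolding split_beta
        by (intro continuous_intros continuous_on_compose2[OF cwt] continuous_on_compose2[OF c\<phi>]) auto
    qed (use \<delta> in auto)
    moreover have "at t within {t / 2..T} = at t"
      using t by (intro at_within_interior) auto
    moreover have "integral {0..J} (\<lambda>x. wt (x, t) * \<phi> x) = d * a t - b t"
    proof -
      have "((\<lambda>x. wxx (x, t) * \<phi> x - w (x, t) * \<phi>'' x) has_integral
          (wx (J, t) * \<phi> J - w (J, t) * \<phi>' J) - (wx (0, t) * \<phi> 0 - w (0, t) * \<phi>' 0)) {0..J}"
      proof (rule fundamental_theorem_of_calculus)
        fix x assume x: "x \<in> {0..J}"
        have "((\<lambda>x. wx (x, t) * \<phi> x - w (x, t) * \<phi>' x) has_real_derivative
            (wx (x, t) * \<phi>' x + wxx (x, t) * \<phi> x) - (w (x, t) * \<phi>'' x + wx (x, t) * \<phi>' x))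
            (at x within {0..})"
          using x \<delta> by (intro DERIV_diff DERIV_mult' dw has_field_derivative_at_within[OF \<phi>]
              has_field_derivative_at_within[OF \<phi>']) auto
        then have "((\<lambda>x. wx (x, t) * \<phi> x - w (x, t) * \<phi>' x) has_real_derivative
            wxx (x, t) * \<phi> x - w (x, t) * \<phi>'' x) (at x within {0..J})"
          by (rule DERIV_cong[OF DERIV_subset]) auto
        then show "((\<lambda>x. wx (x, t) * \<phi> x - w (x, t) * \<phi>' x) has_vector_derivative
            wxx (x, t) * \<phi> x - w (x, t) * \<phi>'' x) (at x within {0..J})"
          by (simp add: has_real_derivative_iff_has_vector_derivative)
      qed (use \<open>0 < J\<close> in simp)
      then have "integral {0..J} (\<lambda>x. wxx (x, t) * \<phi> x - w (x, t) * \<phi>'' x) = 0"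
        using J \<open>\<phi>' 0 = 0\<close> bd[of t] t by (simp add: has_integral_integrable_integral)
      then have parts: "integral {0..J} (\<lambda>x. wxx (x, t) * \<phi> x) = a t"
        unfolding a_def
        by (subst (asm) integral_diff)
          (auto intro!: slice_integrable[OF cwxx] slice_integrable[OF cw] c\<phi> \<phi>'' \<delta>)
      \<comment> \<open>The differential equation is available for \<open>0 < x\<close> only; the
        point \<open>x = 0\<close> is discarded as a null set.\<close>
      have "integral {0..J} (\<lambda>x. wt (x, t) * \<phi> x)
          = integral {0..J} (\<lambda>x. d * (wxx (x, t) * \<phi> x) - f (x, t) * \<phi> x)"
        by (rule integral_spike[of "{0}"]) (use t in \<open>auto simp: eq left_diff_distrib mult.assoc\<close>)
      also have "\<dots> = d * a t - b t"
        unfolding b_def parts[symmetric] using slice_integrable[OF cwxx c\<phi> \<delta>(2), of J]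
        by (subst integral_diff)
          (auto intro!: slice_integrable[OF cf] c\<phi> \<delta> integrable_on_mult_right)
      finally show ?thesis .
    qed
    ultimately show ?thesis
      by (simp add: g_def[abs_def])
  qed
  then have "((\<lambda>t. d * a t - b t) has_integral g T - g 0) {0..T}"
    using g \<open>0 < T\<close> by (intro fundamental_theorem_of_calculus_interior)
      (auto simp: has_real_derivative_iff_has_vector_derivative)
  then have "g T - g 0 = integral {0..T} (\<lambda>t. d * a t - b t)"
    by (simp add: has_integral_integrable_integral)
  also have "\<dots> = d * integral {0..T} a - integral {0..T} b"
    using a b by (subst integral_diff) (auto intro!: integrable_continuous_real continuous_intros)
  finally show ?thesis
    by (simp add: g_def a_def[abs_def] b_def[abs_def])
qed

text \<open>The link between Lebesgue integrals over the strip and the iterated integrals of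
  \<open>classical_balance\<close>, where the space integral is the inner one.\<close>

lemma set_nn_integral_eq_iterated:
  fixes f :: "real \<times> real \<Rightarrow> real"
  assumes cont: "continuous_on ({0..J} \<times> {0..T}) f"
    and nonneg: "\<And>z. z \<in> {0..J} \<times> {0..T} \<Longrightarrow> 0 \<le> f z"
  shows "(\<integral>\<^sup>+z\<in>{0..J} \<times> {0..T}. ennreal (f z) \<partial>lebesgue) =
    ennreal (integral {0..T} (\<lambda>t. integral {0..J} (\<lambda>x. f (x, t))))"
proof -
  have box: "cbox (0, 0) (J, T) = {0..J} \<times> {0..T}"
    by (simp add: cbox_Pair_eq)
  have cont': "continuous_on (cbox (0, 0) (J, T)) f"
    using cont by (simp add: box)
  have "(\<integral>\<^sup>+z\<in>{0..J} \<times> {0..T}. ennreal (f z) \<partial>lebesgue) = ennreal (integral ({0..J} \<times> {0..T}) f)"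
    unfolding nn_integral_completion
    by (rule nn_integral_has_integral_lebesgue'[OF nonneg integrable_integral])
      (use integrable_continuous[OF cont'] in \<open>auto simp: box\<close>)
  also have "integral ({0..J} \<times> {0..T}) f = integral {0..J} (\<lambda>x. integral {0..T} (\<lambda>t. f (x, t)))"
    using integral_prod_continuous[OF cont'] by (simp add: box)
  also have "\<dots> = integral {0..T} (\<lambda>t. integral {0..J} (\<lambda>x. f (x, t)))"
    using integral_swap_continuous[of 0 0 J T "\<lambda>x t. f (x, t)"] cont' by (simp add: case_prod_eta)
  finally show ?thesis .
qed

text \<open>The four summands come from the initial mass and the diffusion of \<open>u\<close>
  tested with the plateau, and from the initial mass and the diffusion of \<open>v\<close> tested
  with the cutoff.\<close>

lemma classical_reaction_bound:
  fixes u v :: "real \<times> real \<Rightarrow> real"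
  assumes "0 < T" and F: "reaction F" and "0 < d\<^sub>u" and "0 < d\<^sub>v" and "0 < k" and "1 \<le> n"
    and sol: "classical_solution T d\<^sub>u d\<^sub>v U\<^sub>0 F k u\<^sub>0 v\<^sub>0 u v"
    and ub: "\<And>z. z \<in> {0..} \<times> {0..T} \<Longrightarrow> 0 \<le> u z \<and> u z \<le> M"
    and vb: "\<And>z. z \<in> {0..} \<times> {0..T} \<Longrightarrow> 0 \<le> v z \<and> v z \<le> M"
    and u\<^sub>0: "set_integrable lborel {0..} u\<^sub>0"
  shows "(\<integral>\<^sup>+z\<in>exhaustion T n. ennreal (k * F (u z) (v z)) \<partial>lebesgue)
    \<le> ennreal (L1_norm {0..} u\<^sub>0 + 6 * d\<^sub>u * M * T + 6 * M + 6 * d\<^sub>v * M * T)"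
proof -
  define f where "f z = k * F (u z) (v z)" for z
  define J where "J = real n + 3"
  have "0 < J" by (simp add: J_def)
  have "(0, 0) \<in> {0 :: real..} \<times> {0..T}"
    using \<open>0 < T\<close> by auto
  then have "0 \<le> M"
    using ub[of "(0, 0)"] by linarith
  obtain ux uxx ut vx vxx vt where
    Cu: "\<And>\<delta>. \<delta> \<in> {0<..<T} \<Longrightarrow> C21_derivs {0..} {\<delta>..T} u ux uxx ut" and
    Cv: "\<And>\<delta>. \<delta> \<in> {0<..<T} \<Longrightarrow> C21_derivs {0..} {\<delta>..T} v vx vxx vt" and
    eq: "\<And>z. z \<in> S T \<Longrightarrow> ut z = d\<^sub>u * uxx z - f z \<and> vt z = d\<^sub>v * vxx z - f z" and
    bd: "\<And>t. t \<in> {0<..<T} \<Longrightarrow> d\<^sub>v * vx (0, t) = 0"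
    using sol unfolding classical_solution_def f_def by blast
  have cu: "continuous_on ({0..} \<times> {0..T}) u" and cv: "continuous_on ({0..} \<times> {0..T}) v"
    and init: "\<And>x. 0 \<le> x \<Longrightarrow> u (x, 0) = u\<^sub>0 x"
    using sol by (auto simp: classical_solution_def)
  have cf: "continuous_on ({0..} \<times> {0..T}) f"
    unfolding f_def
    using continuous_on_compose2[OF reaction_continuous_on[OF F] continuous_on_Pair[OF cu cv]] ub vb
    by (intro continuous_intros) auto
  have fnn: "0 \<le> f z" if "z \<in> {0..} \<times> {0..T}" for z
    using ub[OF that] vb[OF that] F \<open>0 < k\<close> by (simp add: f_def reaction_nonneg)
  have window: "w * p \<le> M * a" if "0 \<le> w" "w \<le> M" "\<bar>p\<bar> \<le> a" for w p a :: real
    using mult_mono[of w M "\<bar>p\<bar>" a] mult_left_mono[OF abs_ge_self[of p], of w] that \<open>0 \<le> M\<close> by simp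
  have diffusion: "integral {0..T} (\<lambda>t. integral {0..J} (\<lambda>x. w (x, t) * p x)) \<le> 6 * M * T"
    if w: "continuous_on ({0..} \<times> {0..T}) w" and p: "continuous_on UNIV p"
      and le: "\<And>x t. x \<in> {0..J} \<Longrightarrow> t \<in> {0..T} \<Longrightarrow>
        w (x, t) * p x \<le> M * (indicator {0..0 + 3} x + indicator {real n..real n + 3} x)" for w p
  proof -
    have "integral {0..T} (\<lambda>t. integral {0..J} (\<lambda>x. w (x, t) * p x)) \<le> integral {0..T} (\<lambda>t. 6 * M)"
      by (intro integral_le integrable_continuous_real continuous_on_slice_integral w p
          integral_le_windows[where a = 0 and b = "real n"] slice_integrable[OF w p] le \<open>0 \<le> M\<close>) auto
    then show ?thesis
      using \<open>0 < T\<close> by (simp add: mult_ac)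
  qed
  have pos: "0 \<le> integral {0..J} (\<lambda>x. w (x, t) * p x)"
    if "continuous_on ({0..} \<times> {0..T}) w" "continuous_on UNIV p"
      "\<And>z. z \<in> {0..} \<times> {0..T} \<Longrightarrow> 0 \<le> w z" "\<And>x. 0 \<le> p x" "t \<in> {0..T}"
    for w :: "real \<times> real \<Rightarrow> real" and p t
    using that by (intro Henstock_Kurzweil_Integration.integral_nonneg slice_integrable[OF that(1)]) auto
  have U: "integral {0..T} (\<lambda>t. integral {0..J} (\<lambda>x. f (x, t) * plateau n x))
      \<le> L1_norm {0..} u\<^sub>0 + 6 * d\<^sub>u * M * T"
  proof -
    have "integral {0..T} (\<lambda>t. integral {0..J} (\<lambda>x. f (x, t) * plateau n x)) =
        integral {0..J} (\<lambda>x. u (x, 0) * plateau n x) - integral {0..J} (\<lambda>x. u (x, T) * plateau n x) +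
        d\<^sub>u * integral {0..T} (\<lambda>t. integral {0..J} (\<lambda>x. u (x, t) * plateau'' n x))"
      by (rule classical_balance[OF \<open>0 < T\<close> \<open>0 < J\<close> cu cf Cu _ has_real_derivative_plateau continuous_plateau(2)])
        (use eq in \<open>auto simp: S_def J_def plateau_0 plateau_above\<close>)
    moreover have "integral {0..J} (\<lambda>x. u (x, 0) * plateau n x) \<le> L1_norm {0..} u\<^sub>0"
    proof -
      have nn: "0 \<le> u\<^sub>0 x" if "0 \<le> x" for x
        using ub[of "(x, 0)"] init[OF that] that \<open>0 < T\<close> by auto
      have i: "set_integrable lborel {0..} (\<lambda>x. u\<^sub>0 x * plateau n x)"
        and le: "(LINT x:{0..}|lborel. u\<^sub>0 x * plateau n x) \<le> L1_norm {0..} u\<^sub>0"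
        using L1_norm_weighted[OF u\<^sub>0 nn continuous_plateau(1) plateau_nonneg plateau_le_1] by auto
      have "integral {0..J} (\<lambda>x. u (x, 0) * plateau n x) = integral {0..J} (\<lambda>x. u\<^sub>0 x * plateau n x)"
        by (intro Henstock_Kurzweil_Integration.integral_cong) (auto simp: init)
      also have "\<dots> \<le> integral {0..} (\<lambda>x. u\<^sub>0 x * plateau n x)"
        using set_borel_integral_eq_integral(1)[OF i]
          set_borel_integral_eq_integral(1)[OF set_integrable_subset[OF i]] nn plateau_nonneg plateau_le_1
        by (intro integral_subset_le) auto
      finally show ?thesis
        using le set_borel_integral_eq_integral(2)[OF i] by simp
    qed
    moreover have "0 \<le> integral {0..J} (\<lambda>x. u (x, T) * plateau n x)"
      using pos[OF cu continuous_plateau(1), where t = T] ub plateau_nonneg plateau_le_1 \<open>0 < T\<close> by auto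
    moreover have "d\<^sub>u * integral {0..T} (\<lambda>t. integral {0..J} (\<lambda>x. u (x, t) * plateau'' n x)) \<le> d\<^sub>u * (6 * M * T)"
    proof (intro mult_left_mono diffusion cu continuous_plateau(2))
      fix x t assume "x \<in> {0..J}" "t \<in> {0..T}"
      then have "0 \<le> u (x, t)" "u (x, t) \<le> M"
        using ub[of "(x, t)"] by auto
      then show "u (x, t) * plateau'' n x \<le> M * (indicator {0..0 + 3} x + indicator {real n..real n + 3} x)"
        using abs_plateau''_le by (rule window)
    qed (use \<open>0 < d\<^sub>u\<close> in auto)
    ultimately show ?thesis
      by (simp add: mult_ac)
  qed
  have V: "integral {0..T} (\<lambda>t. integral {0..J} (\<lambda>x. f (x, t) * cutoff x)) \<le> 6 * M + 6 * d\<^sub>v * M * T"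
  proof -
    have "integral {0..T} (\<lambda>t. integral {0..J} (\<lambda>x. f (x, t) * cutoff x)) =
        integral {0..J} (\<lambda>x. v (x, 0) * cutoff x) - integral {0..J} (\<lambda>x. v (x, T) * cutoff x) +
        d\<^sub>v * integral {0..T} (\<lambda>t. integral {0..J} (\<lambda>x. v (x, t) * cutoff'' x))"
      by (rule classical_balance[OF \<open>0 < T\<close> \<open>0 < J\<close> cv cf Cv _ has_real_derivative_cutoff
            has_real_derivative_cutoff' continuous_cutoff''])
        (use eq bd \<open>0 < d\<^sub>v\<close> in \<open>auto simp: S_def J_def cutoff_above cutoff_below\<close>)
    \<comment> \<open>Both windows are the interval \<open>[0, 3]\<close>; counting it twice costs a
      factor 2.\<close>
    moreover have "integral {0..J} (\<lambda>x. v (x, 0) * cutoff x) \<le> 6 * M"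
    proof (rule integral_le_windows[where a = 0 and b = 0])
      show "(\<lambda>x. v (x, 0) * cutoff x) integrable_on {0..J}"
        using \<open>0 < T\<close> by (intro slice_integrable[OF cv continuous_cutoff]) auto
      fix x assume "x \<in> {0..J}"
      then have "0 \<le> v (x, 0)" "v (x, 0) \<le> M" "0 \<le> x"
        using vb[of "(x, 0)"] \<open>0 < T\<close> by auto
      moreover have "cutoff x \<le> indicator {0..0 + 3} x + indicator {0..0 + 3} x" if "0 \<le> x"
        using cutoff_le_1[of x] cutoff_above(1)[of x] that by (auto simp: indicator_def)
      ultimately show "v (x, 0) * cutoff x \<le> M * (indicator {0..0 + 3} x + indicator {0..0 + 3} x)"
        using \<open>0 \<le> M\<close> cutoff_nonneg by (intro mult_mono) auto
    qed (fact \<open>0 \<le> M\<close>)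
    moreover have "0 \<le> integral {0..J} (\<lambda>x. v (x, T) * cutoff x)"
      using pos[OF cv continuous_cutoff, of T] vb cutoff_nonneg \<open>0 < T\<close> by auto
    moreover have "d\<^sub>v * integral {0..T} (\<lambda>t. integral {0..J} (\<lambda>x. v (x, t) * cutoff'' x)) \<le> d\<^sub>v * (6 * M * T)"
    proof (intro mult_left_mono diffusion cv continuous_cutoff'')
      fix x t assume "x \<in> {0..J}" "t \<in> {0..T}"
      then have "0 \<le> v (x, t)" "v (x, t) \<le> M"
        using vb[of "(x, t)"] by auto
      \<comment> \<open>The first window alone would do; the second one is added to fit
        \<open>diffusion\<close>.\<close>
      moreover have "\<bar>cutoff'' x\<bar> \<le> indicator {0..0 + 3} x + indicator {real n..real n + 3} x"
        using abs_cutoff''_le[of x] by (auto intro: order_trans)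
      ultimately show "v (x, t) * cutoff'' x \<le> M * (indicator {0..0 + 3} x + indicator {real n..real n + 3} x)"
        by (rule window)
    qed (use \<open>0 < d\<^sub>v\<close> in auto)
    ultimately show ?thesis
      by (simp add: mult_ac)
  qed
  \<comment> \<open>The weight \<open>cutoff (x - n)\<close> is 1 on the exhausting set and is then
    split into plateau plus cutoff, the weights of \<open>U\<close> and \<open>V\<close>.\<close>
  have "(\<integral>\<^sup>+z\<in>exhaustion T n. ennreal (f z) \<partial>lebesgue)
      \<le> (\<integral>\<^sup>+z\<in>{0..J} \<times> {0..T}. ennreal (f z * cutoff (fst z - real n)) \<partial>lebesgue)"
  proof (intro nn_integral_mono)
    fix z
    have "z \<in> {0..J} \<times> {0..T} \<and> cutoff (fst z - real n) = 1" if "z \<in> exhaustion T n"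
    proof -
      have "z \<in> S T"
        using exhaustion_subset[OF \<open>1 \<le> n\<close>] that by auto
      then show ?thesis
        using that by (auto simp: exhaustion_def S_def J_def cutoff_below)
    qed
    then show "ennreal (f z) * indicator (exhaustion T n) z
        \<le> ennreal (f z * cutoff (fst z - real n)) * indicator ({0..J} \<times> {0..T}) z"
      by (auto simp: indicator_def)
  qed
  also have "\<dots> = ennreal (integral {0..T} (\<lambda>t. integral {0..J} (\<lambda>x. f (x, t) * cutoff (x - real n))))"
  proof (subst set_nn_integral_eq_iterated)
    show "continuous_on ({0..J} \<times> {0..T}) (\<lambda>z. f z * cutoff (fst z - real n))"
      by (intro continuous_intros continuous_on_compose2[OF continuous_cutoff] continuous_on_subset[OF cf]) auto
    show "0 \<le> f z * cutoff (fst z - real n)" if "z \<in> {0..J} \<times> {0..T}" for z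
      using that fnn[of z] cutoff_nonneg by (auto simp: mem_Times_iff)
  qed simp
  also have "integral {0..T} (\<lambda>t. integral {0..J} (\<lambda>x. f (x, t) * cutoff (x - real n))) =
      integral {0..T} (\<lambda>t. integral {0..J} (\<lambda>x. f (x, t) * plateau n x) + integral {0..J} (\<lambda>x. f (x, t) * cutoff x))"
  proof (rule Henstock_Kurzweil_Integration.integral_cong)
    fix t assume t: "t \<in> {0..T}"
    have "integral {0..J} (\<lambda>x. f (x, t) * cutoff (x - real n)) =
        integral {0..J} (\<lambda>x. f (x, t) * plateau n x + f (x, t) * cutoff x)"
      by (simp add: plateau_def algebra_simps)
    also have "\<dots> = integral {0..J} (\<lambda>x. f (x, t) * plateau n x) + integral {0..J} (\<lambda>x. f (x, t) * cutoff x)"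
      by (intro Henstock_Kurzweil_Integration.integral_add slice_integrable[OF cf] continuous_plateau(1) continuous_cutoff t)
    finally show "integral {0..J} (\<lambda>x. f (x, t) * cutoff (x - real n)) =
        integral {0..J} (\<lambda>x. f (x, t) * plateau n x) + integral {0..J} (\<lambda>x. f (x, t) * cutoff x)" .
  qed
  also have "\<dots> = integral {0..T} (\<lambda>t. integral {0..J} (\<lambda>x. f (x, t) * plateau n x)) +
      integral {0..T} (\<lambda>t. integral {0..J} (\<lambda>x. f (x, t) * cutoff x))"
    by (intro Henstock_Kurzweil_Integration.integral_add integrable_continuous_real
        continuous_on_slice_integral cf continuous_plateau(1) continuous_cutoff)
  finally show ?thesis
    using U V unfolding f_def by (elim order_trans) (intro ennreal_leI, simp)
qed

section \<open>Weak solutions\<close>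

lemma S_open: "open (S T)"
  unfolding S_def by (intro open_Times) auto

lemma S_sets: "S T \<in> sets lebesgue"
  using S_open by simp

text \<open>The solution spaces give measurability on bounded rectangles only; countably many of
  these cover the strip. Their lengths are \<open>Suc m\<close> in order to be positive.\<close>

lemma borel_measurable_strip:
  fixes w :: "real \<times> real \<Rightarrow> real"
  assumes "\<And>J. 0 < J \<Longrightarrow> w \<in> borel_measurable (lebesgue_on ({0<..<J} \<times> {0<..<T}))"
  shows "w \<in> borel_measurable (lebesgue_on (S T))"
proof (rule measurable_piecewise_restrict)
  let ?R = "\<lambda>m::nat. {0<..<real (Suc m)} \<times> {0<..<T}"
  have R: "?R m \<in> sets lebesgue" for m
    by (intro lmeasurable_open borel_open sets_completionI_sets) (simp_all add: open_Times)
  have sub: "S T \<inter> ?R m = ?R m" for m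
    by (auto simp: S_def)
  show "countable (range ?R)" by simp
  show "\<Omega> \<inter> space (lebesgue_on (S T)) \<in> sets (lebesgue_on (S T))" if "\<Omega> \<in> range ?R" for \<Omega>
    using that R S_sets by (auto simp: sets_restrict_space Int_commute)
  show "space (lebesgue_on (S T)) \<subseteq> \<Union> (range ?R)"
  proof
    fix z assume "z \<in> space (lebesgue_on (S T))"
    moreover obtain m :: nat where "real m > fst z"
      using reals_Archimedean2 by blast
    ultimately have "z \<in> ?R m"
      by (auto simp: S_def)
    then show "z \<in> \<Union> (range ?R)" by blast
  qed
  show "w \<in> borel_measurable (restrict_space (lebesgue_on (S T)) \<Omega>)" if \<Omega>: "\<Omega> \<in> range ?R" for \<Omega>
  proof -
    obtain m where m: "\<Omega> = ?R m"
      using \<Omega> by blast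
    have "restrict_space (lebesgue_on (S T)) \<Omega> = lebesgue_on \<Omega>"
      unfolding m using R S_sets by (subst restrict_restrict_space) (simp_all add: sub del: of_nat_Suc)
    then show ?thesis
      using assms[of "real (Suc m)"] by (simp add: m)
  qed
qed

text \<open>\<open>F\<close> is continuous on the quadrant only, and \<open>u\<close>,
  \<open>v\<close> lie there merely almost everywhere. Clamping the arguments at 0 gives a function
  continuous on the whole plane; completeness of Lebesgue measure then absorbs the exceptional null
  set.\<close>

lemma reaction_borel_measurable:
  fixes u v :: "real \<times> real \<Rightarrow> real"
  assumes F: "reaction F" and \<Omega>: "\<Omega> \<in> sets lebesgue"
    and u: "u \<in> borel_measurable (lebesgue_on \<Omega>)" and v: "v \<in> borel_measurable (lebesgue_on \<Omega>)"
    and ae: "AE z in lebesgue_on \<Omega>. 0 \<le> u z \<and> 0 \<le> v z"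
  shows "(\<lambda>z. F (u z) (v z)) \<in> borel_measurable (lebesgue_on \<Omega>)"
proof -
  define G where "G p = F (max 0 (fst p)) (max 0 (snd p))" for p :: "real \<times> real"
  have "continuous_on UNIV (\<lambda>p :: real \<times> real. (max 0 (fst p), max 0 (snd p)))"
    by (intro continuous_intros)
  then have "continuous_on UNIV G"
    unfolding G_def using continuous_on_compose2[OF reaction_continuous_on[OF F]] by fastforce
  then have "(\<lambda>z. G (u z, v z)) \<in> borel_measurable (lebesgue_on \<Omega>)"
    using borel_measurable_continuous_Pair[OF u v, of "\<lambda>a b. G (a, b)"] by simp
  then have "(\<lambda>z. G (u z, v z) * indicator \<Omega> z) \<in> borel_measurable lebesgue"
    using \<Omega> by (simp add: borel_measurable_restrict_space_iff mult.commute)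
  moreover have "AE z in lebesgue. G (u z, v z) * indicator \<Omega> z = F (u z) (v z) * indicator \<Omega> z"
  proof -
    have "AE z in lebesgue. z \<in> \<Omega> \<longrightarrow> 0 \<le> u z \<and> 0 \<le> v z"
      using ae \<Omega> by (subst (asm) AE_restrict_space_iff) auto
    then show ?thesis
      by eventually_elim (auto simp: G_def indicator_def)
  qed
  ultimately have "(\<lambda>z. F (u z) (v z) * indicator \<Omega> z) \<in> borel_measurable lebesgue"
    by (rule borel_measurable_AE)
  then show ?thesis
    using \<Omega> by (simp add: borel_measurable_restrict_space_iff mult.commute)
qed

lemma integrable_indicator_strip:
  fixes A :: "(real \<times> real) set"
  assumes "A = {a..b} \<times> {0..T}" and "a \<le> b" and "0 < T"
  shows "integrable (lebesgue_on (S T)) (indicator A :: _ \<Rightarrow> real)"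
    and "(LINT z|lebesgue_on (S T). indicator A z) \<le> (b - a) * T"
proof -
  have A: "A = cbox (a, 0) (b, T)"
    by (simp add: assms cbox_Pair_eq)
  have AS: "A \<inter> S T \<in> sets lebesgue"
    using S_sets by (simp add: A sets.Int)
  have "emeasure (lebesgue_on (S T)) (A \<inter> S T) = emeasure lebesgue (A \<inter> S T)"
    using S_sets by (intro emeasure_restrict_space) auto
  also have "\<dots> \<le> emeasure lebesgue A"
    by (intro emeasure_mono) (auto simp: A)
  also have "\<dots> = ennreal ((b - a) * T)"
    using assms(2,3) by (simp add: A emeasure_lborel_cbox_eq content_Pair Basis_prod_def ennreal_mult'' mult.commute)
  finally have le: "emeasure (lebesgue_on (S T)) (A \<inter> S T) \<le> ennreal ((b - a) * T)" .
  have sets: "A \<inter> S T \<in> sets (lebesgue_on (S T))"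
    using AS S_sets by (simp add: sets_restrict_space_iff)
  have "integrable (lebesgue_on (S T)) (indicator (A \<inter> S T) :: _ \<Rightarrow> real)"
    using le sets by (intro integrable_real_indicator) (auto simp: le_less_trans)
  then show "integrable (lebesgue_on (S T)) (indicator A :: _ \<Rightarrow> real)"
    by (rule Bochner_Integration.integrable_cong[THEN iffD1, rotated -1]) (auto simp: indicator_def)
  have "(LINT z|lebesgue_on (S T). indicator A z) = measure (lebesgue_on (S T)) (A \<inter> S T)"
    by simp
  also have "\<dots> \<le> (b - a) * T"
    using le assms(2,3) by (simp add: measure_def enn2real_leI)
  finally show "(LINT z|lebesgue_on (S T). indicator A z) \<le> (b - a) * T" .
qed

lemma C21_derivs_product:
  assumes \<phi>: "\<And>x. (\<phi> has_real_derivative \<phi>' x) (at x)" "\<And>x. (\<phi>' has_real_derivative \<phi>'' x) (at x)"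
      "continuous_on UNIV \<phi>''"
    and \<tau>: "\<And>t. (\<tau> has_real_derivative \<tau>' t) (at t)" "continuous_on UNIV \<tau>'"
  shows "C21_derivs X I (\<lambda>z. \<phi> (fst z) * \<tau> (snd z)) (\<lambda>z. \<phi>' (fst z) * \<tau> (snd z))
    (\<lambda>z. \<phi>'' (fst z) * \<tau> (snd z)) (\<lambda>z. \<phi> (fst z) * \<tau>' (snd z))"
proof -
  have c: "continuous_on UNIV \<phi>" "continuous_on UNIV \<phi>'" "continuous_on UNIV \<tau>"
    using \<phi> \<tau> by (auto intro!: continuous_at_imp_continuous_on DERIV_isCont)
  have [continuous_intros]: "continuous_on A (\<lambda>z. p (fst z))" "continuous_on A (\<lambda>z. p (snd z))"
    if "continuous_on UNIV p" for A :: "(real \<times> real) set" and p :: "real \<Rightarrow> real"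
    by (rule continuous_on_compose2[OF that]; auto intro!: continuous_intros)+
  show ?thesis
    unfolding C21_derivs_def
    by (intro conjI ballI continuous_intros c \<phi>(3) \<tau>(2))
      (auto intro!: DERIV_cmult DERIV_cmult_right has_field_derivative_at_within[OF \<phi>(1)]
        has_field_derivative_at_within[OF \<phi>(2)] has_field_derivative_at_within[OF \<tau>(1)])
qed

text \<open>Weak test functions vanish at \<open>x = 0\<close> and at \<open>t = T\<close>. Hence
  \<open>\<rho>\<close> takes the place of the cutoff, and the factor \<open>\<tau>\<close>,
  descending on \<open>[T - 3 / n, T]\<close>, that of the evaluation at the final time. The summand
  \<open>3 * M\<close> bounds the initial mass of \<open>v\<close> under \<open>\<rho>\<close>,
  which vanishes beyond \<open>x = 3\<close>; there is no diffusion of \<open>v\<close>.\<close>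

lemma weak_reaction_bound:
  fixes u v :: "real \<times> real \<Rightarrow> real"
  assumes "0 < T" and F: "reaction F" and "0 < d\<^sub>u" and "0 < k" and "1 \<le> n" and "0 \<le> M"
    and sol: "weak_solution T d\<^sub>u U\<^sub>0 F k u\<^sub>0 v\<^sub>0 u v"
    and meas: "(\<lambda>z. F (u z) (v z)) \<in> borel_measurable (lebesgue_on (S T))"
      "u \<in> borel_measurable (lebesgue_on (S T))"
    and ae: "AE z in lebesgue_on (S T). 0 \<le> u z \<and> u z \<le> M \<and> 0 \<le> v z \<and> v z \<le> M"
    and u\<^sub>0: "set_integrable lborel {0..} u\<^sub>0" "\<And>x. 0 \<le> x \<Longrightarrow> 0 \<le> u\<^sub>0 x"
    and v\<^sub>0: "\<And>x. 0 \<le> x \<Longrightarrow> 0 \<le> v\<^sub>0 x \<and> v\<^sub>0 x \<le> M"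
  shows "(\<integral>\<^sup>+z\<in>exhaustion T n. ennreal (k * F (u z) (v z)) \<partial>lebesgue)
    \<le> ennreal (L1_norm {0..} u\<^sub>0 + 6 * d\<^sub>u * M * T + 3 * M)"
proof -
  let ?L = "lebesgue_on (S T)"
  define f where "f z = k * F (u z) (v z)" for z
  define J where "J = real n + 3"
  \<comment> \<open>For \<open>x \<ge> 0\<close> the subtracted term lives in the layer
    \<open>[0, 3 / n]\<close>; it enforces \<open>\<rho> 0 = 0\<close> and leaves the cutoff
    unchanged beyond.\<close>
  define \<rho> where "\<rho> x = cutoff x - cutoff (real n * x)" for x
  define \<rho>' where "\<rho>' x = cutoff' x - real n * cutoff' (real n * x)" for x
  \<comment> \<open>This is of order \<open>n^2\<close>, but it serves only to certify the
    regularity of the test function: the identity for \<open>v\<close> contains no space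
    derivative.\<close>
  define \<rho>'' where "\<rho>'' x = cutoff'' x - real n * (real n * cutoff'' (real n * x))" for x
  define \<tau> where "\<tau> t = cutoff (real n * (t - T) + 3)" for t
  define \<tau>' where "\<tau>' t = real n * cutoff' (real n * (t - T) + 3)" for t
  have meas_f: "f \<in> borel_measurable ?L"
    unfolding f_def using meas(1) by measurable
  \<comment> \<open>Monotonicity in both arguments gives a bound that depends on \<open>k\<close>;
    it is used for integrability and does not enter the final constant.\<close>
  have fb: "AE z in ?L. 0 \<le> f z \<and> f z \<le> k * F M M"
    using ae
  proof eventually_elim
    case (elim z)
    have "F (u z) (v z) \<le> F M (v z)"
      using F elim \<open>0 \<le> M\<close> by (auto simp: reaction_def dest!: spec[of _ "v z"] elim!: mono_onD)
    also have "\<dots> \<le> F M M"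
      using F elim \<open>0 \<le> M\<close> by (auto simp: reaction_def dest!: spec[of _ M] elim!: mono_onD)
    finally show ?case
      using elim \<open>0 < k\<close> F by (simp add: f_def reaction_nonneg)
  qed
  have lin: "((\<lambda>x. real n * x) has_real_derivative real n) (at x)"
    "((\<lambda>x. real n * (x - T) + 3) has_real_derivative real n) (at x)" for x
    by (auto intro!: derivative_eq_intros)
  have d\<rho>: "(\<rho> has_real_derivative \<rho>' x) (at x)" for x
    unfolding \<rho>_def[abs_def] \<rho>'_def[abs_def]
    using DERIV_chain2[OF has_real_derivative_cutoff lin(1)]
    by (intro DERIV_diff has_real_derivative_cutoff) (simp add: mult.commute)
  have d\<rho>': "(\<rho>' has_real_derivative \<rho>'' x) (at x)" for x
    unfolding \<rho>'_def[abs_def] \<rho>''_def[abs_def]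
    using DERIV_chain2[OF has_real_derivative_cutoff' lin(1)]
    by (intro DERIV_diff has_real_derivative_cutoff' DERIV_cmult) (simp add: mult.commute)
  have d\<tau>: "(\<tau> has_real_derivative \<tau>' t) (at t)" for t
    unfolding \<tau>_def[abs_def] \<tau>'_def[abs_def]
    using DERIV_chain2[OF has_real_derivative_cutoff lin(2)] by (simp add: mult.commute)
  have c: "continuous_on UNIV \<rho>" "continuous_on UNIV \<rho>''"
    "continuous_on UNIV \<tau>" "continuous_on UNIV \<tau>'"
    unfolding \<rho>_def[abs_def] \<rho>''_def[abs_def] \<tau>_def[abs_def] \<tau>'_def[abs_def]
    by (auto intro!: continuous_intros)
  have [measurable]: "(\<lambda>z. p (fst z)) \<in> borel_measurable ?L" "(\<lambda>z. p (snd z)) \<in> borel_measurable ?L"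
    if "continuous_on UNIV p" for p :: "real \<Rightarrow> real"
    using S_sets by (intro continuous_imp_measurable_on_sets_lebesgue
        continuous_on_compose2[OF that] continuous_intros; simp)+
  have n1: "x \<le> real n * x" if "0 \<le> x" for x
    using that \<open>1 \<le> n\<close> by (simp add: mult_le_cancel_right1)
  have \<rho>01: "0 \<le> \<rho> x" "\<rho> x \<le> 1" if "0 \<le> x" for x
    using cutoff_antimono[OF n1[OF that]] cutoff_le_1[of x] cutoff_nonneg[of "real n * x"]
    by (auto simp: \<rho>_def)
  have \<tau>01: "0 \<le> \<tau> t" "\<tau> t \<le> 1" and \<tau>': "\<tau>' t \<le> 0" for t
    using cutoff_nonneg cutoff_le_1 cutoff'_nonpos by (auto simp: \<tau>_def \<tau>'_def mult_nonneg_nonpos)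
  have plateau_J: "plateau n x = 0" if "x > J" for x
    using plateau_above(1)[of n x] that by (simp add: J_def)
  have \<rho>_above: "\<rho> x = 0" if "x > J" for x
  proof -
    have "3 \<le> x" "3 \<le> real n * x"
      using that n1[of x] unfolding J_def by linarith+
    then show ?thesis
      by (simp add: \<rho>_def cutoff_above)
  qed
  have zero: "\<rho> 0 = 0" "\<tau> T = 0"
    by (simp_all add: \<rho>_def \<tau>_def cutoff_below cutoff_above)
  have weak_form:
    "(LINT z|?L. u z * (p (fst z) * \<tau>' (snd z))) +
       (LINT z|?L. d\<^sub>u * u z * (p'' (fst z) * \<tau> (snd z)) - f z * (p (fst z) * \<tau> (snd z))) =
       - (LINT x:{0..}|lborel. u\<^sub>0 x * (p x * \<tau> 0)) - d\<^sub>u * U\<^sub>0 * (LINT t:{0..T}|lborel. p' 0 * \<tau> t) \<and>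
     (LINT z|?L. v z * (p (fst z) * \<tau>' (snd z))) - (LINT z|?L. f z * (p (fst z) * \<tau> (snd z))) =
       - (LINT x:{0..}|lborel. v\<^sub>0 x * (p x * \<tau> 0))"
    if "\<And>x. (p has_real_derivative p' x) (at x)" "\<And>x. (p' has_real_derivative p'' x) (at x)"
      "continuous_on UNIV p''" "p 0 = 0" "\<And>x. x > J \<Longrightarrow> p x = 0" for p p' p''
  proof -
    have "0 < J" by (simp add: J_def)
    then have "\<exists>J>0. \<forall>x>J. \<forall>t\<in>{0..T}. p x * \<tau> t = 0"
      using that(5) by auto
    then show ?thesis
      using sol[unfolded weak_solution_def, THEN conjunct2, THEN conjunct2,
        rule_format, of "\<lambda>z. p (fst z) * \<tau> (snd z)" "\<lambda>z. p' (fst z) * \<tau> (snd z)"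
          "\<lambda>z. p'' (fst z) * \<tau> (snd z)" "\<lambda>z. p (fst z) * \<tau>' (snd z)"]
        C21_derivs_product[OF that(1-3) d\<tau> c(4), of "{0..}" "{0..T}"] that(4,5) zero(2)
      unfolding f_def by (auto 0 0 simp: mult.assoc)
  qed
  \<comment> \<open>The counterpart of dropping the term at time \<open>T\<close>. Should the
    integrand fail to be integrable, the default value 0 of the integral satisfies the bound as
    well.\<close>
  have dissipation: "(LINT z|?L. w z * (p (fst z) * \<tau>' (snd z))) \<le> 0"
    if "AE z in ?L. 0 \<le> w z" "\<And>x. 0 \<le> x \<Longrightarrow> 0 \<le> p x" for w and p :: "real \<Rightarrow> real"
  proof -
    have "AE z in ?L. 0 \<le> - (w z * (p (fst z) * \<tau>' (snd z)))"
      using that(1) AE_space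
    proof eventually_elim
      case (elim z)
      have "0 \<le> fst z"
        using elim(2) by (auto simp: S_def)
      then have "0 \<le> p (fst z)"
        by (rule that(2))
      then have "p (fst z) * \<tau>' (snd z) \<le> 0"
        using \<tau>' by (intro mult_nonneg_nonpos)
      then show ?case
        using elim(1) by (simp add: mult_nonneg_nonpos)
    qed
    then have "0 \<le> (LINT z|?L. - (w z * (p (fst z) * \<tau>' (snd z))))"
      by (rule integral_nonneg_AE)
    then show ?thesis
      by simp
  qed
  note box = integrable_indicator_strip[OF refl _ \<open>0 < T\<close>]
  \<comment> \<open>Integrability allows the combined integral of diffusion and reaction in the weak
    form to be split, and later the two tested reaction terms to be added.\<close>
  have int: "integrable ?L (\<lambda>z. f z * (p (fst z) * \<tau> (snd z)))"
    if p: "continuous_on UNIV p" "\<And>x. 0 \<le> x \<Longrightarrow> 0 \<le> p x" "\<And>x. 0 \<le> x \<Longrightarrow> p x \<le> 1" "\<And>x. x > J \<Longrightarrow> p x = 0" for p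
  proof (rule Bochner_Integration.integrable_bound)
    show "integrable ?L (\<lambda>z. k * F M M * indicator ({0..J} \<times> {0..T}) z)"
      by (intro integrable_mult_right box) (simp add: J_def)
    show "(\<lambda>z. f z * (p (fst z) * \<tau> (snd z))) \<in> borel_measurable ?L"
      using meas_f p(1) c(3) by measurable
    show "AE z in ?L. norm (f z * (p (fst z) * \<tau> (snd z))) \<le> norm (k * F M M * indicator ({0..J} \<times> {0..T}) z)"
      using fb AE_space
    proof eventually_elim
      case (elim z)
      show ?case
      proof (cases "fst z > J")
        case False
        have "0 < fst z" "0 < snd z" "snd z < T"
          using elim(2) by (auto simp: S_def)
        then have "0 \<le> p (fst z) * \<tau> (snd z)" "p (fst z) * \<tau> (snd z) \<le> 1"
          using p(2,3)[of "fst z"] \<tau>01 by (auto intro!: mult_le_one)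
        moreover have "z \<in> {0..J} \<times> {0..T}"
          using False \<open>0 < fst z\<close> \<open>0 < snd z\<close> \<open>snd z < T\<close> by (simp add: mem_Times_iff)
        moreover from calculation have "0 \<le> f z * (p (fst z) * \<tau> (snd z))"
          "f z * (p (fst z) * \<tau> (snd z)) \<le> k * F M M"
          using elim(1) mult_mono[of "f z" "k * F M M" "p (fst z) * \<tau> (snd z)" 1] by auto
        ultimately show ?thesis
          by simp
      qed (simp add: p(4))
    qed
  qed
  have int_plateau: "integrable ?L (\<lambda>z. f z * (plateau n (fst z) * \<tau> (snd z)))"
    using continuous_plateau(1) plateau_nonneg plateau_le_1 by (intro int) (auto simp: J_def plateau_above)
  have int_\<rho>: "integrable ?L (\<lambda>z. f z * (\<rho> (fst z) * \<tau> (snd z)))"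
    using c(1) \<rho>01 \<rho>_above by (intro int) auto
  \<comment> \<open>A majorant of the diffusion term, carried by the two windows over the whole time
    interval.\<close>
  define W where "W z = d\<^sub>u * M * (indicator ({0..0 + 3} \<times> {0..T}) z + indicator ({real n..real n + 3} \<times> {0..T}) z)"
    for z :: "real \<times> real"
  have W: "integrable ?L W" "(LINT z|?L. W z) \<le> d\<^sub>u * M * (3 * T + 3 * T)"
  proof -
    note b1 = box[where a = 0 and b = "0 + 3"]
    note b2 = box[where a = "real n" and b = "real n + 3"]
    show "integrable ?L W"
      unfolding W_def by (intro integrable_mult_right Bochner_Integration.integrable_add b1 b2) auto
    have "(LINT z|?L. W z) = d\<^sub>u * M * ((LINT z|?L. indicator ({0..0 + 3} \<times> {0..T}) z) +
        (LINT z|?L. indicator ({real n..real n + 3} \<times> {0..T}) z))"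
      unfolding W_def by (subst integral_mult_right_zero, subst Bochner_Integration.integral_add)
        (use b1 b2 in auto)
    also have "\<dots> \<le> d\<^sub>u * M * (3 * T + 3 * T)"
      using b1(2) b2(2) \<open>0 < d\<^sub>u\<close> \<open>0 \<le> M\<close> by (intro mult_left_mono add_mono) auto
    finally show "(LINT z|?L. W z) \<le> d\<^sub>u * M * (3 * T + 3 * T)" .
  qed
  have diff: "AE z in ?L. \<bar>d\<^sub>u * u z * (plateau'' n (fst z) * \<tau> (snd z))\<bar> \<le> W z"
    using ae AE_space
  proof eventually_elim
    case (elim z)
    then have z: "0 < snd z" "snd z < T"
      by (auto simp: S_def)
    have "\<bar>plateau'' n (fst z)\<bar> \<le> indicator {0..0 + 3} (fst z) + indicator {real n..real n + 3} (fst z)"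
      by (rule abs_plateau''_le)
    also have "\<dots> = indicator ({0..0 + 3} \<times> {0..T}) z + indicator ({real n..real n + 3} \<times> {0..T}) z"
      using z by (auto simp: indicator_def mem_Times_iff)
    finally have "\<bar>plateau'' n (fst z) * \<tau> (snd z)\<bar> \<le>
        indicator ({0..0 + 3} \<times> {0..T}) z + indicator ({real n..real n + 3} \<times> {0..T}) z"
      using \<tau>01[of "snd z"] by (auto simp: abs_mult intro: order_trans[OF mult_left_le])
    moreover have "\<bar>d\<^sub>u * u z\<bar> \<le> d\<^sub>u * M"
      using elim(1) \<open>0 < d\<^sub>u\<close> by (simp add: abs_mult)
    ultimately show ?case
      unfolding W_def abs_mult[of "d\<^sub>u * u z"] using \<open>0 < d\<^sub>u\<close> \<open>0 \<le> M\<close> by (intro mult_mono) auto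
  qed
  have int_diff: "integrable ?L (\<lambda>z. d\<^sub>u * u z * (plateau'' n (fst z) * \<tau> (snd z)))"
  proof (rule Bochner_Integration.integrable_bound[OF W(1)])
    show "(\<lambda>z. d\<^sub>u * u z * (plateau'' n (fst z) * \<tau> (snd z))) \<in> borel_measurable ?L"
      using meas(2) continuous_plateau(2) c(3) by measurable
    show "AE z in ?L. norm (d\<^sub>u * u z * (plateau'' n (fst z) * \<tau> (snd z))) \<le> norm (W z)"
      using diff by eventually_elim auto
  qed
  have U: "(LINT z|?L. f z * (plateau n (fst z) * \<tau> (snd z))) \<le> L1_norm {0..} u\<^sub>0 + 6 * d\<^sub>u * M * T"
  proof -
    \<comment> \<open>The boundary term with \<open>U\<^sub>0\<close> has disappeared, since it
      carries the factor \<open>plateau' n 0 = 0\<close>.\<close>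
    have "(LINT z|?L. u z * (plateau n (fst z) * \<tau>' (snd z))) +
        ((LINT z|?L. d\<^sub>u * u z * (plateau'' n (fst z) * \<tau> (snd z))) - (LINT z|?L. f z * (plateau n (fst z) * \<tau> (snd z)))) =
        - (LINT x:{0..}|lborel. u\<^sub>0 x * (plateau n x * \<tau> 0))"
      using weak_form[OF has_real_derivative_plateau continuous_plateau(2) plateau_0(1) plateau_J] plateau_0(2)
      by (simp add: Bochner_Integration.integral_diff[OF int_diff int_plateau])
    moreover have "(LINT z|?L. u z * (plateau n (fst z) * \<tau>' (snd z))) \<le> 0"
      using ae plateau_nonneg plateau_le_1 by (intro dissipation) auto
    moreover have "(LINT z|?L. d\<^sub>u * u z * (plateau'' n (fst z) * \<tau> (snd z))) \<le> (LINT z|?L. W z)"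
      using diff by (intro integral_mono_AE int_diff W(1)) auto
    moreover have "(LINT x:{0..}|lborel. u\<^sub>0 x * (plateau n x * \<tau> 0)) \<le> L1_norm {0..} u\<^sub>0"
      using plateau_nonneg plateau_le_1 \<tau>01 continuous_plateau(1) by (intro L1_norm_weighted(2) u\<^sub>0 mult_nonneg_nonneg mult_le_one continuous_intros) auto
    ultimately show ?thesis
      using W(2) by (simp add: algebra_simps)
  qed
  have V: "(LINT z|?L. f z * (\<rho> (fst z) * \<tau> (snd z))) \<le> 3 * M"
  proof -
    have "(LINT z|?L. v z * (\<rho> (fst z) * \<tau>' (snd z))) - (LINT z|?L. f z * (\<rho> (fst z) * \<tau> (snd z))) =
        - (LINT x:{0..}|lborel. v\<^sub>0 x * (\<rho> x * \<tau> 0))"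
      using weak_form[OF d\<rho> d\<rho>' c(2) zero(1) \<rho>_above] by blast
    moreover have "(LINT z|?L. v z * (\<rho> (fst z) * \<tau>' (snd z))) \<le> 0"
      using ae \<rho>01 by (intro dissipation) auto
    moreover have "(LINT x:{0..}|lborel. v\<^sub>0 x * (\<rho> x * \<tau> 0)) \<le> (LINT x|lborel. M * indicator {0..3::real} x)"
      unfolding set_lebesgue_integral_def
    proof (rule integral_mono')
      show "integrable lborel (\<lambda>x. M * indicator {0..3::real} x)"
        by (intro integrable_mult_right integrable_real_indicator) auto
      fix x :: real
      show "0 \<le> M * indicator {0..3} x"
        using \<open>0 \<le> M\<close> by simp
      show "indicator {0..} x *\<^sub>R (v\<^sub>0 x * (\<rho> x * \<tau> 0)) \<le> M * indicator {0..3} x"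
      proof (cases "0 \<le> x")
        case True
        have "\<rho> x = 0" if "3 < x"
          using that True \<rho>01(1)[of x] cutoff_above(1)[of x] cutoff_nonneg[of "real n * x"]
          unfolding \<rho>_def by linarith
        then have "\<rho> x * \<tau> 0 \<le> indicator {0..3} x"
          using True \<rho>01[of x] \<tau>01[of 0] by (cases "x \<le> 3") (auto simp: mult_le_one)
        then show ?thesis
          using True v\<^sub>0[of x] \<rho>01[of x] \<tau>01[of 0] by (auto intro!: mult_mono)
      qed simp
    qed
    ultimately show ?thesis
      by simp
  qed
  \<comment> \<open>The sum equals \<open>(cutoff (x - n) - cutoff (n * x)) * \<tau> t\<close>; on
    the exhausting set the three factors are 1, 0 and 1.\<close>
  define \<psi> where "\<psi> z = plateau n (fst z) * \<tau> (snd z) + \<rho> (fst z) * \<tau> (snd z)" for z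
  have int_\<psi>: "integrable ?L (\<lambda>z. f z * \<psi> z)"
    unfolding \<psi>_def distrib_left by (intro Bochner_Integration.integrable_add int_plateau int_\<rho>)
  have \<psi>: "0 \<le> \<psi> z" if "z \<in> S T" for z
    using that plateau_nonneg plateau_le_1 \<rho>01 \<tau>01 by (auto simp: \<psi>_def S_def)
  have \<psi>1: "\<psi> z = 1" if "z \<in> exhaustion T n" for z
  proof -
    have "3 / real n \<le> fst z" "fst z \<le> real n" "snd z \<le> T - 3 / real n"
      using that by (auto simp: exhaustion_def)
    then have "3 \<le> real n * fst z" "fst z - real n \<le> 0" "real n * (snd z - T) + 3 \<le> 0"
      using \<open>1 \<le> n\<close> by (auto simp: field_simps)
    then show ?thesis
      by (simp add: \<psi>_def plateau_def \<rho>_def \<tau>_def cutoff_above cutoff_below)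
  qed
  have "(\<integral>\<^sup>+z\<in>exhaustion T n. ennreal (f z) \<partial>lebesgue)
      \<le> (\<integral>\<^sup>+z. ennreal (f z * \<psi> z) * indicator (S T) z \<partial>lebesgue)"
    using exhaustion_subset[OF \<open>1 \<le> n\<close>, of T] \<psi>1 by (intro nn_integral_mono) (auto simp: indicator_def)
  also have "\<dots> = (\<integral>\<^sup>+z. ennreal (f z * \<psi> z) \<partial>?L)"
    using S_sets by (subst nn_integral_restrict_space) auto
  also have "\<dots> = ennreal (LINT z|?L. f z * \<psi> z)"
  proof (rule nn_integral_eq_integral[OF int_\<psi>])
    show "AE z in ?L. 0 \<le> f z * \<psi> z"
      using fb AE_space by eventually_elim (use \<psi> in auto)
  qed
  also have "(LINT z|?L. f z * \<psi> z) =
      (LINT z|?L. f z * (plateau n (fst z) * \<tau> (snd z))) + (LINT z|?L. f z * (\<rho> (fst z) * \<tau> (snd z)))"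
    unfolding \<psi>_def distrib_left by (rule Bochner_Integration.integral_add[OF int_plateau int_\<rho>])
  finally show ?thesis
    using U V unfolding f_def by (elim order_trans) (intro ennreal_leI, simp)
qed

section \<open>The uniform bound on the reaction\<close>

text \<open>Convergence of the data as \<open>k\<close> tends to infinity controls the
  \<open>L1\<close> norm of \<open>u\<^sub>0 k\<close> for large \<open>k\<close> only;
  \<open>u\<^sub>0_L1_bounded\<close> supplies a bound for all \<open>k > 0\<close>. With integrals
  in \<open>ennreal\<close>, finiteness is part of the conclusion.\<close>

theorem lemma3p4:
  fixes T d\<^sub>u D U\<^sub>0 V\<^sub>0 M :: real
    and F :: "real \<Rightarrow> real \<Rightarrow> real"
    and u\<^sub>0 v\<^sub>0 :: "real \<Rightarrow> real \<Rightarrow> real"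
  assumes "T > 0" and "U\<^sub>0 > 0" and "V\<^sub>0 > 0" and "M \<ge> max U\<^sub>0 V\<^sub>0"
    and "reaction F"
    and "initial_data V\<^sub>0 M u\<^sub>0 v\<^sub>0"
    and u\<^sub>0_L1_bounded: "\<exists>B. \<forall>k>0. L1_norm {0..} (u\<^sub>0 k) \<le> B"
    and "d\<^sub>u > 0" and "D > 0"
  shows "\<exists>C>0. \<forall>d\<^sub>v\<in>{0..D}. \<forall>k>0. \<forall>u v.
           solution T d\<^sub>u d\<^sub>v U\<^sub>0 F k (u\<^sub>0 k) (v\<^sub>0 k) u v \<and>
           (AE z in lebesgue_on ({0..} \<times> {0<..<T}). 0 \<le> u z \<and> u z \<le> M \<and> 0 \<le> v z \<and> v z \<le> M) \<longrightarrow>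
           (\<integral>\<^sup>+t\<in>{0<..<T}. (\<integral>\<^sup>+x\<in>{0<..}. ennreal (k * F (u (x, t)) (v (x, t))) \<partial>lborel) \<partial>lborel)
             \<le> ennreal C"
proof -
  obtain B where B: "\<And>k. 0 < k \<Longrightarrow> L1_norm {0..} (u\<^sub>0 k) \<le> B"
    using u\<^sub>0_L1_bounded by blast
  have "0 < M"
    using assms(2,4) by simp
  have data: "set_integrable lborel {0..} (u\<^sub>0 k)"
    "\<And>x. 0 \<le> x \<Longrightarrow> 0 \<le> u\<^sub>0 k x \<and> u\<^sub>0 k x \<le> M \<and> 0 \<le> v\<^sub>0 k x \<and> v\<^sub>0 k x \<le> M" if "0 < k" for k
    using \<open>initial_data V\<^sub>0 M u\<^sub>0 v\<^sub>0\<close> that by (simp_all add: initial_data_def)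
  \<comment> \<open>The classical bound with \<open>D\<close> for \<open>d\<^sub>v\<close> and
    \<open>\<bar>B\<bar>\<close> for the norm of the data; it also dominates the weak bound, where
    \<open>d\<^sub>v = 0\<close> and \<open>3 * M\<close> replaces \<open>6 * M\<close>.\<close>
  define C where "C = \<bar>B\<bar> + 6 * d\<^sub>u * M * T + 6 * M + 6 * D * M * T"
  have "0 < C"
    unfolding C_def using \<open>0 < M\<close> \<open>d\<^sub>u > 0\<close> \<open>D > 0\<close> \<open>T > 0\<close>
    by (intro add_pos_pos add_nonneg_pos mult_pos_pos abs_ge_zero) auto
  have strip: "S T \<subseteq> {0..} \<times> {0<..<T}"
    by (auto simp: S_def)
  show ?thesis
  proof (intro exI[of _ C] conjI \<open>0 < C\<close> ballI allI impI, elim conjE)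
    fix d\<^sub>v k u v
    assume d\<^sub>v: "d\<^sub>v \<in> {0..D}" and "(0 :: real) < k"
      and sol: "solution T d\<^sub>u d\<^sub>v U\<^sub>0 F k (u\<^sub>0 k) (v\<^sub>0 k) u v"
      and ae: "AE z in lebesgue_on ({0..} \<times> {0<..<T}). 0 \<le> u z \<and> u z \<le> M \<and> 0 \<le> v z \<and> v z \<le> M"
    have le_C: "L1_norm {0..} (u\<^sub>0 k) + 6 * d\<^sub>u * M * T + 6 * M + 6 * d\<^sub>v * M * T \<le> C"
    proof -
      have "6 * d\<^sub>v * M * T \<le> 6 * D * M * T"
        using d\<^sub>v \<open>0 < M\<close> \<open>T > 0\<close> by (intro mult_right_mono) auto
      then show ?thesis
        using B[OF \<open>0 < k\<close>] by (simp add: C_def)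
    qed
    have "{0 :: real..} \<times> {0<..<T} \<in> sets lebesgue"
      by (intro sets_completionI_sets) (simp add: borel_Times)
    then have "AE z in lebesgue. z \<in> {0..} \<times> {0<..<T} \<longrightarrow> 0 \<le> u z \<and> u z \<le> M \<and> 0 \<le> v z \<and> v z \<le> M"
      using ae by (subst (asm) AE_restrict_space_iff) auto
    then have aeS: "AE z in lebesgue_on (S T). 0 \<le> u z \<and> u z \<le> M \<and> 0 \<le> v z \<and> v z \<le> M"
      using strip S_sets by (subst AE_restrict_space_iff) auto
    show "(\<integral>\<^sup>+t\<in>{0<..<T}. (\<integral>\<^sup>+x\<in>{0<..}. ennreal (k * F (u (x, t)) (v (x, t))) \<partial>lborel) \<partial>lborel)
        \<le> ennreal C"
    proof (cases "d\<^sub>v > 0")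
      case True
      then have csol: "classical_solution T d\<^sub>u d\<^sub>v U\<^sub>0 F k (u\<^sub>0 k) (v\<^sub>0 k) u v"
        using sol by (simp add: solution_def)
      then have cu: "continuous_on ({0..} \<times> {0..T}) u" and cv: "continuous_on ({0..} \<times> {0..T}) v"
        by (simp_all add: classical_solution_def)
      have closure: "closure (S T) = {0..} \<times> {0..T}"
        using \<open>T > 0\<close> by (simp add: S_def closure_Times)
      have ub: "0 \<le> u z \<and> u z \<le> M" and vb: "0 \<le> v z \<and> v z \<le> M" if "z \<in> {0..} \<times> {0..T}" for z
        using ae_imp_on_closure[OF S_open, of T u 0 M z] ae_imp_on_closure[OF S_open, of T v 0 M z]
          aeS cu cv that by (auto simp: closure)
      have "continuous_on ({0..} \<times> {0..T}) (\<lambda>z. k * F (u z) (v z))"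
        using continuous_on_compose2[OF reaction_continuous_on[OF \<open>reaction F\<close>] continuous_on_Pair[OF cu cv]]
          ub vb by (intro continuous_intros) auto
      then have "continuous_on (S T) (\<lambda>z. k * F (u z) (v z))"
        by (rule continuous_on_subset) (auto simp: S_def)
      then show ?thesis
        using classical_reaction_bound[OF \<open>T > 0\<close> \<open>reaction F\<close> \<open>d\<^sub>u > 0\<close> True \<open>0 < k\<close> _ csol ub vb
            data(1)[OF \<open>0 < k\<close>]] ennreal_leI[OF le_C] S_sets
        by (intro iterated_nn_integral_le_of_exhaustion continuous_imp_measurable_on_sets_lebesgue)
          (auto intro: order_trans)
    next
      case False
      then have "d\<^sub>v = 0" and wsol: "weak_solution T d\<^sub>u U\<^sub>0 F k (u\<^sub>0 k) (v\<^sub>0 k) u v"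
        using d\<^sub>v sol by (simp_all add: solution_def)
      have mu: "u \<in> borel_measurable (lebesgue_on (S T))"
      proof (rule borel_measurable_strip)
        fix J :: real assume "0 < J"
        then have "in_W21p 1 ({0<..<J} \<times> {0<..<T}) u"
          using wsol by (simp add: weak_solution_def)
        then show "u \<in> borel_measurable (lebesgue_on ({0<..<J} \<times> {0<..<T}))"
          by (simp add: in_W21p_def in_Lp_def)
      qed
      have mv: "v \<in> borel_measurable (lebesgue_on (S T))"
      proof (rule borel_measurable_strip)
        fix J :: real assume "0 < J"
        then have "in_W1inf_Linf {0<..<T} {0<..<J} v"
          using wsol by (simp add: weak_solution_def)
        then show "v \<in> borel_measurable (lebesgue_on ({0<..<J} \<times> {0<..<T}))"
          by (simp add: in_W1inf_Linf_def in_Linf_Linf_def)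
      qed
      have mF: "(\<lambda>z. F (u z) (v z)) \<in> borel_measurable (lebesgue_on (S T))"
        using aeS by (intro reaction_borel_measurable[OF \<open>reaction F\<close> S_sets mu mv]) auto
      have "L1_norm {0..} (u\<^sub>0 k) + 6 * d\<^sub>u * M * T + 3 * M \<le> C"
        using le_C \<open>d\<^sub>v = 0\<close> \<open>0 < M\<close> by simp
      then have "(\<integral>\<^sup>+z\<in>exhaustion T n. ennreal (k * F (u z) (v z)) \<partial>lebesgue) \<le> ennreal C" if "1 \<le> n" for n
        using weak_reaction_bound[OF \<open>T > 0\<close> \<open>reaction F\<close> \<open>d\<^sub>u > 0\<close> \<open>0 < k\<close> that _ wsol mF mu aeS
            data(1)[OF \<open>0 < k\<close>]] data(2)[OF \<open>0 < k\<close>] \<open>0 < M\<close>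
        by (auto intro: order_trans ennreal_leI)
      then show ?thesis
        using mF by (intro iterated_nn_integral_le_of_exhaustion) auto
    qed
  qed
qed

end
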